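(* Let $r\ge1$. The series $P_r(x,v)$ is a polynomial in $\mathbb Z[x,v]$, and it can be written as \[ P_r(x,v)=2c_{r,0}(x)+\sum_{\ell=1}^{r}c_{r,\ell}(x)(1-x)^{\ell-1}(1-2x)^{\ell}v^{\ell} \] with $c_{r,i}(x)\in\mathbb Z[x]$ for all $0\le i\le r$. Moreover: $\deg c_{r,0}(x)=3r-1$ for all $r\ge4$ and $c_{r,0}(1/2)=2^{1-r}$ for all $r\ge1$; and $\deg c_{r,\ell}(x)=3r-2\ell$ for all $r\ge4$ and all $1\le\ell\le r$.
   Context: The standard cycle form of a permutation $\sigma$ of $\{1,\dots,n\}$ writes $\sigma$ as a product of disjoint cycles (fixed points included as 1-cycles), each cycle written starting with its smallest letter, the cycles arranged in increasing order of their smallest letters. $\mathrm{Flatten}(\sigma)$ is the word obtained by erasing the parentheses of the standard cycle form. An occurrence of the pattern 13-2 in a word $w_1\cdots w_n$ is a pair of indices $(i,j)$ with $2\le i<j\le n$ and $w_{i-1}<w_j<w_i$. For $r\ge0$, $g_{n,r}(1i)$ denotes the number of permutations $\pi$ of $\{1,\dots,n\}$ such that $\mathrm{Flatten}(\pi)$ starts with $1i$ and has exactly $r$ occurrences of 13-2. Set $G_r(x,v)=\sum_{n\ge r+3}\sum_{i=2}^n g_{n,r}(1i)v^{i-2}x^n$ (a polynomial of degree $r$ in $v$ with coefficients in $\mathbb Z[[x]]$) and $P_r(x,v)=\frac{(1-x)^{2r-1}(1-2x)^{r+1}}{2x^{r+3}}G_r(x,v)$. The $c_{r,i}(x)$ are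 defined as the (a priori power series) coefficients in the displayed expansion of $P_r$ in powers of $v$. *)

theory Defs
  imports
    "HOL-Combinatorics.Cycles"
    "HOL-Computational_Algebra.Polynomial_FPS"
begin

text \<open>
  The letters selected below are those that are smallest in their own cycle, and
  \<open>support \<pi> a\<close> is the cycle \<open>[a, \<pi> a, \<pi> (\<pi> a), \<dots>]\<close> written from the letter \<open>a\<close>.
\<close>

definition standard_cycle_form :: "nat \<Rightarrow> (nat \<Rightarrow> nat) \<Rightarrow> nat list list" where
  "standard_cycle_form n \<pi> =
     map (support \<pi>) (sorted_list_of_set {a \<in> {1..n}. \<forall>k. a \<le> (\<pi> ^^ k) a})"

definition flatten :: "nat \<Rightarrow> (nat \<Rightarrow> nat) \<Rightarrow> nat list" where
  "flatten n \<pi> = concat (standard_cycle_form n \<pi>)"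

text \<open>
  Positions in a list are counted from 0, so the condition \<open>2 \<le> i < j \<le> n\<close> on the
  1-based positions of a word becomes \<open>1 \<le> i < j < n\<close>.
\<close>

definition occurrences_13_2 :: "nat list \<Rightarrow> nat" where
  "occurrences_13_2 w =
     card {(i, j). 1 \<le> i \<and> i < j \<and> j < length w \<and> w ! (i - 1) < w ! j \<and> w ! j < w ! i}"

definition g :: "nat \<Rightarrow> nat \<Rightarrow> nat \<Rightarrow> nat" where
  "g n r i = card {\<pi>. \<pi> permutes {1..n} \<and> take 2 (flatten n \<pi>) = [1, i] \<and>
                      occurrences_13_2 (flatten n \<pi>) = r}"

text \<open>
  Series in \<open>x\<close> and \<open>v\<close> are elements of \<open>\<rat>[v][[x]]\<close>, of type \<^typ>\<open>rat poly fps\<close>: the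
  coefficient of each power of \<open>x\<close> is a polynomial in \<open>v\<close>. Here \<^term>\<open>fps_X\<close> is \<open>x\<close>.
\<close>

definition var_v :: "rat poly fps" where
  "var_v = fps_const [:0, 1:]"

definition of_x_series :: "rat fps \<Rightarrow> rat poly fps" where
  "of_x_series f = Abs_fps (\<lambda>n. [:fps_nth f n:])"

definition v_coeff :: "rat poly fps \<Rightarrow> nat \<Rightarrow> rat fps" where
  "v_coeff F l = Abs_fps (\<lambda>n. coeff (fps_nth F n) l)"

text \<open>
  An integer polynomial in \<open>x\<close> and \<open>v\<close> is given as a polynomial in \<open>x\<close> whose
  coefficients are polynomials in \<open>v\<close>.
\<close>

definition of_xv_poly :: "int poly poly \<Rightarrow> rat poly fps" where
  "of_xv_poly p = fps_of_poly (map_poly (map_poly of_int) p)"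

definition G :: "nat \<Rightarrow> rat poly fps" where
  "G r = Abs_fps (\<lambda>n. if r + 3 \<le> n then \<Sum>i=2..n. monom (of_nat (g n r i)) (i - 2) else 0)"

text \<open>
  The coefficients of \<open>G r\<close> below \<open>x\<close>-degree \<open>r + 3\<close> vanish, so the shift is the exact
  division by \<open>x^(r+3)\<close>. For \<open>r \<ge> 1\<close> the natural number \<open>2 * r - 1\<close> is not truncated.
\<close>

definition P :: "nat \<Rightarrow> rat poly fps" where
  "P r = (1 - fps_X) ^ (2 * r - 1) * (1 - 2 * fps_X) ^ (r + 1) *
         fps_const [:1/2:] * fps_shift (r + 3) (G r)"

text \<open>
  The expansion
  \<open>P r = 2 * c r 0 + (\<Sum>l=1..r. c r l * (1 - x)^(l-1) * (1 - 2*x)^l * v^l)\<close>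
  determines \<open>c r l\<close> as a power series in \<open>x\<close> by comparing coefficients of \<open>v^l\<close>;
  the divisors have constant term 1 or 2, hence are units.
\<close>

definition c :: "nat \<Rightarrow> nat \<Rightarrow> rat fps" where
  "c r l = (if l = 0 then v_coeff (P r) 0 / 2
            else v_coeff (P r) l / ((1 - fps_X) ^ (l - 1) * (1 - 2 * fps_X) ^ l))"

end

theory Submission
  imports Defs "HOL-Combinatorics.Multiset_Permutations"
begin

text \<open>
  A word \<open>1 # w\<close> is the flattening of \<open>2\<^sup>m\<close> permutations, \<open>m\<close> being the number of
  right-to-left minima of \<open>w\<close>. Removing the first letter \<open>i\<close> of a word whose second letter is \<open>j\<close>
  (after renaming) destroys \<open>max 0 (j - i)\<close> occurrences of 13-2, so the weighted numbers of words
  with first letter \<open>i\<close> and \<open>r + 1 - i\<close> occurrences, for \<open>1 \<le> i \<le> r + 1\<close>, satisfy a linear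
  recurrence in the length that is triangular in \<open>i\<close>, with diagonal \<open>2, 1, \<dots>, 1\<close> and an
  inhomogeneous part coming from smaller \<open>r\<close>. This makes their generating functions rational with
  powers of \<open>1 - x\<close> and \<open>1 - 2x\<close> as denominators, and only the case \<open>i \<le> 2\<close> matters for the value
  of the numerator of \<open>i = 1\<close> at \<open>1/2\<close>. The recurrence is already valid at length \<open>r + 1\<close>, one step
  before the series begins; the behaviour at infinity of a rational function is given by the
  backward continuation of its coefficients, so the leading coefficient of the numerator is, up to
  a nonzero factor, the weighted number of words of length \<open>r + 1\<close>, which is positive for
  \<open>r \<ge> 4\<close>.
\<close>

section \<open>Standard cycle forms\<close>

text \<open>Comparing the head of a block with everything after it encodes both conventions at once:
  each cycle starts with its minimum, and the minima increase.\<close>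

fun canonical :: "nat list list \<Rightarrow> bool" where
  "canonical [] \<longleftrightarrow> True"
| "canonical (b # cs) \<longleftrightarrow>
     b \<noteq> [] \<and> (\<forall>y \<in> set (tl b) \<union> set (concat cs). hd b < y) \<and> canonical cs"

lemma support_nonempty:
  assumes "permutation p"
  shows "support p a \<noteq> []" "hd (support p a) = a" "a \<in> set (support p a)"
proof -
  obtain m where m: "least_power p a = Suc m"
    using least_power_of_permutation(2)[OF assms, of a] by (metis Suc_pred)
  have eq: "support p a = a # map (\<lambda>i. (p ^^ i) a) [1..<Suc m]"
    unfolding m by (subst upt_conv_Cons) auto
  show "support p a \<noteq> []" "hd (support p a) = a" "a \<in> set (support p a)"
    unfolding eq by (rule list.distinct list.sel list.set_intros)+
qed

lemma support_cases:
  assumes "permutation p"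
  shows "set (support p a) = set (support p b) \<or> set (support p a) \<inter> set (support p b) = {}"
  using disjoint_support[OF assms] unfolding disjoint_def by (meson rangeI)

text \<open>A head \<open>a\<close> is smaller than every letter of a later block
  \<open>S b\<close>, so it does not occur there; blocks that are equal or disjoint as sets must
  then be disjoint.\<close>

lemma canonical_map:
  assumes "sorted_wrt (<) xs"
    and "\<And>a. a \<in> set xs \<Longrightarrow> S a \<noteq> [] \<and> hd (S a) = a \<and> distinct (S a) \<and> (\<forall>y\<in>set (S a). a \<le> y)"
    and "\<And>a b. set (S a) = set (S b) \<or> set (S a) \<inter> set (S b) = {}"
  shows "canonical (map S xs) \<and> distinct (concat (map S xs))"
  using assms(1,2)
proof (induction xs)
  case (Cons a xs)
  have Sa: "S a \<noteq> []" "hd (S a) = a" "distinct (S a)" "\<forall>y\<in>set (S a). a \<le> y"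
    using Cons.prems(2)[of a] by auto
  have later: "\<forall>y\<in>set (S b). a < y" if b: "b \<in> set xs" for b
    using Cons.prems(1) Cons.prems(2)[of b] b by fastforce
  obtain u where u: "S a = a # u" using Sa(1,2) by (cases "S a") auto
  have "\<forall>y\<in>set (tl (S a)). a < y"
    using Sa(3,4) unfolding u by (auto simp: order.strict_iff_order)
  moreover have "set (S a) \<inter> set (S b) = {}" if "b \<in> set xs" for b
    using later[OF that] assms(3)[of a b] u by auto
  ultimately show ?case
    using Cons Sa later by auto
qed simp

lemma canonical_map_support:
  assumes "permutation p" "sorted_wrt (<) xs" "\<forall>a\<in>set xs. \<forall>k. a \<le> (p ^^ k) a"
  shows "canonical (map (support p) xs) \<and> distinct (concat (map (support p) xs))"
proof (rule canonical_map[OF assms(2) _ support_cases[OF assms(1)]])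
  fix a assume "a \<in> set xs"
  then have "\<forall>y\<in>set (support p a). a \<le> y"
    using assms(3) by auto
  then show "support p a \<noteq> [] \<and> hd (support p a) = a \<and> distinct (support p a) \<and>
      (\<forall>y\<in>set (support p a). a \<le> y)"
    using support_nonempty[OF assms(1), of a] cycle_of_permutation[OF assms(1), of a] by blast
qed

definition canonical_forms :: "nat \<Rightarrow> nat list list set" where
  "canonical_forms n = {cs. canonical cs \<and> distinct (concat cs) \<and> set (concat cs) = {1..n}}"

abbreviation cycle_minima :: "nat \<Rightarrow> (nat \<Rightarrow> nat) \<Rightarrow> nat set" where
  "cycle_minima n p \<equiv> {a \<in> {1..n}. \<forall>k. a \<le> (p ^^ k) a}"

lemma standard_cycle_form_in_canonical_forms:
  assumes "p permutes {1..n}"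
  shows "standard_cycle_form n p \<in> canonical_forms n"
proof -
  have perm: "permutation p"
    using assms by (auto simp: permutation_permutes)
  let ?xs = "sorted_list_of_set (cycle_minima n p)"
  have fin: "finite (cycle_minima n p)" by simp
  have "canonical (map (support p) ?xs) \<and> distinct (concat (map (support p) ?xs))"
    by (rule canonical_map_support[OF perm]) (use fin in \<open>auto simp del: sorted_list_of_set_eq_Nil_iff\<close>)
  moreover have "set (concat (map (support p) ?xs)) = (\<Union>a\<in>cycle_minima n p. set (support p a))"
    by (simp only: set_concat set_map set_sorted_list_of_set[OF fin] image_image)
  moreover have "\<dots> = {1..n}"
  proof (intro equalityI subsetI)
    fix x assume "x \<in> (\<Union>a\<in>cycle_minima n p. set (support p a))"
    then obtain a where a: "a \<in> {1..n}" "x \<in> set (support p a)" by blast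
    then obtain k where "x = (p ^^ k) a" by auto
    then show "x \<in> {1..n}"
      using a(1) permutes_in_image[OF permutes_funpow[OF assms], of k a] by simp
  next
    fix x assume x: "x \<in> {1..n}"
    \<comment> \<open>The cycle through \<open>x\<close> is the one listed under its least
      letter.\<close>
    define a where "a = Min (set (support p x))"
    have ne: "set (support p x) \<noteq> {}" using support_nonempty(3)[OF perm, of x] by (metis empty_iff)
    then have a_in: "a \<in> set (support p x)"
      unfolding a_def by (intro Min_in) auto
    then have eq: "set (support p a) = set (support p x)"
      using support_cases[OF perm, of a x] support_nonempty(3)[OF perm, of a] by blast
    have "a \<le> (p ^^ k) a" for k
    proof -
      have "(p ^^ k) a \<in> set (support p x)"
        using eq support_set[OF perm, of a] by blast
      then show ?thesis unfolding a_def by (intro Min_le) auto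
    qed
    moreover obtain k where "a = (p ^^ k) x" using a_in by auto
    then have "a \<in> {1..n}"
      using x permutes_in_image[OF permutes_funpow[OF assms], of k x] by simp
    ultimately show "x \<in> (\<Union>a\<in>cycle_minima n p. set (support p a))"
      using eq support_nonempty(3)[OF perm, of x] by blast
  qed
  ultimately show ?thesis
    by (simp add: standard_cycle_form_def canonical_forms_def)
qed

lemma standard_cycle_form_apply:
  assumes "p permutes {1..n}" "cs \<in> set (standard_cycle_form n p)" "x \<in> set cs"
  shows "p x = cycle_of_list cs x"
proof -
  have "permutation p"
    using assms(1) by (auto simp: permutation_permutes)
  moreover obtain a where "cs = support p a"
    using assms(2) by (auto simp: standard_cycle_form_def)
  ultimately show ?thesis
    using cycle_restrict[of p x a] assms(3) by blast
qed

lemma inj_on_standard_cycle_form: "inj_on (standard_cycle_form n) {p. p permutes {1..n}}"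
proof (rule inj_onI)
  fix p q
  assume pq: "p \<in> {p. p permutes {1..n}}" "q \<in> {p. p permutes {1..n}}"
    and eq: "standard_cycle_form n p = standard_cycle_form n q"
  show "p = q"
  proof
    fix x
    show "p x = q x"
    proof (cases "x \<in> {1..n}")
      case True
      then have "x \<in> set (concat (standard_cycle_form n p))"
        using standard_cycle_form_in_canonical_forms[of p n] pq by (simp add: canonical_forms_def)
      then obtain cs where "cs \<in> set (standard_cycle_form n p)" "x \<in> set cs" by auto
      then show ?thesis
        using standard_cycle_form_apply[of p n cs x] standard_cycle_form_apply[of q n cs x] eq pq
        by simp
    next
      case False
      then show ?thesis using pq by (simp add: permutes_not_in)
    qed
  qed
qed

section \<open>The permutation with a prescribed cycle form\<close>

definition perm_of_cycles :: "'a list list \<Rightarrow> 'a \<Rightarrow> 'a" where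
  "perm_of_cycles cs = foldr (\<lambda>b f. cycle_of_list b \<circ> f) cs id"

lemma perm_of_cycles_simps [simp]:
  "perm_of_cycles [] = id"
  "perm_of_cycles (b # cs) = cycle_of_list b \<circ> perm_of_cycles cs"
  by (simp_all add: perm_of_cycles_def)

lemma perm_of_cycles_permutes: "perm_of_cycles cs permutes set (concat cs)"
proof (induction cs)
  case (Cons b cs)
  have "cycle_of_list b permutes set (concat (b # cs))"
    by (rule permutes_subset[OF cycle_permutes]) auto
  moreover have "perm_of_cycles cs permutes set (concat (b # cs))"
    by (rule permutes_subset[OF Cons.IH]) auto
  ultimately show ?case by (simp only: perm_of_cycles_simps permutes_compose)
qed (simp add: permutes_id flip: id_def)

lemma perm_of_cycles_apply:
  assumes "distinct (concat cs)" "b \<in> set cs" "x \<in> set b"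
  shows "perm_of_cycles cs x = cycle_of_list b x"
  using assms
proof (induction cs)
  case (Cons d cs)
  show ?case
  proof (cases "x \<in> set d")
    case True
    then have "x \<notin> set (concat cs)" using Cons.prems by auto
    then have "perm_of_cycles cs x = x" by (rule permutes_not_in[OF perm_of_cycles_permutes])
    moreover have "b = d" using True \<open>x \<notin> set (concat cs)\<close> Cons.prems by auto
    ultimately show ?thesis by simp
  next
    case False
    then have b: "b \<in> set cs" using Cons.prems by auto
    \<comment> \<open>The image stays in its own block, so the outer factor belonging to
      \<open>d\<close> fixes it.\<close>
    have "cycle_of_list b x \<in> set b"
      using Cons.prems(3) permutes_in_image[OF cycle_permutes] by metis
    then have "cycle_of_list b x \<notin> set d" using Cons.prems(1) b by auto
    then show ?thesis using Cons b by (simp add: id_outside_supp)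
  qed
qed simp

text \<open>On the letters of \<open>b\<close> the product acts as the single cycle
  \<open>b\<close>, whose powers rotate the list. The orbit of the head therefore reads off
  \<open>b\<close>, and distinctness makes \<open>length b\<close> the least period.\<close>

lemma support_perm_of_cycles:
  assumes "distinct (concat cs)" "b \<in> set cs" "b \<noteq> []"
  shows "support (perm_of_cycles cs) (hd b) = b"
proof -
  let ?p = "perm_of_cycles cs"
  have dc: "distinct b" using assms by (auto simp: distinct_concat_iff)
  have iter: "(?p ^^ k) (hd b) = (cycle_of_list b ^^ k) (hd b) \<and> (cycle_of_list b ^^ k) (hd b) \<in> set b" for k
  proof (induction k)
    case (Suc k)
    then show ?case
      using perm_of_cycles_apply[OF assms(1,2)] permutes_in_image[OF cycle_permutes]
      by (metis comp_apply funpow.simps(2))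
  qed (use assms in auto)
  have pow: "(?p ^^ k) (hd b) = b ! (k mod length b)" for k
  proof -
    have "(?p ^^ k) (hd b) = map (cycle_of_list b ^^ k) b ! 0"
      using iter assms(3) by (simp add: hd_conv_nth)
    also have "\<dots> = b ! (k mod length b)"
      using assms(3) by (simp add: cyclic_rotation[OF dc] nth_rotate)
    finally show ?thesis .
  qed
  have lp: "least_power ?p (hd b) = length b"
    unfolding least_power_def
  proof (rule Least_equality)
    show "(?p ^^ length b) (hd b) = hd b \<and> 0 < length b"
      using assms(3) by (simp only: pow) (simp add: hd_conv_nth)
    fix m assume m: "(?p ^^ m) (hd b) = hd b \<and> 0 < m"
    then have "m mod length b = 0"
      using assms(3) dc by (simp only: pow) (simp add: hd_conv_nth nth_eq_iff_index_eq)
    then show "length b \<le> m" using m by (auto dest: dvd_imp_le)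
  qed
  show ?thesis
    by (rule nth_equalityI) (simp_all add: lp pow)
qed

lemma canonical_nonempty: "canonical cs \<Longrightarrow> b \<in> set cs \<Longrightarrow> b \<noteq> []"
  by (induction cs) auto

lemma canonical_hd_le:
  assumes "canonical cs" "b \<in> set cs" "x \<in> set b"
  shows "hd b \<le> x"
  using assms
proof (induction cs)
  case (Cons d cs)
  show ?case
  proof (cases "b = d")
    case True
    then show ?thesis using Cons.prems by (cases d) (auto intro: less_imp_le)
  next
    case False
    then show ?thesis using Cons by auto
  qed
qed simp

lemma sorted_hd_canonical: "canonical cs \<Longrightarrow> sorted_wrt (<) (map hd cs)"
proof (induction cs)
  case (Cons b cs)
  have "d \<noteq> []" if "d \<in> set cs" for d
    using that Cons.prems canonical_nonempty[of cs d] by simp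
  then show ?case using Cons by fastforce
qed simp

text \<open>Each block is the whole cycle of its head, and the head is its minimum, so the cycle
  minima are exactly the heads. These already increase, so sorting keeps the order of the
  blocks.\<close>

lemma standard_cycle_form_perm_of_cycles:
  assumes "cs \<in> canonical_forms n"
  shows "standard_cycle_form n (perm_of_cycles cs) = cs"
proof -
  let ?p = "perm_of_cycles cs"
  have cs: "canonical cs" "distinct (concat cs)" "set (concat cs) = {1..n}"
    using assms by (auto simp: canonical_forms_def)
  have perm: "?p permutes {1..n}" using perm_of_cycles_permutes[of cs] cs(3) by simp
  then have permn: "permutation ?p" by (auto simp: permutation_permutes)
  have "cycle_minima n ?p = set (map hd cs)"
  proof (intro equalityI subsetI)
    fix a assume a: "a \<in> cycle_minima n ?p"
    then have "a \<in> set (concat cs)" using cs(3) by blast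
    then obtain b where b: "b \<in> set cs" "a \<in> set b" by auto
    have sup: "support ?p (hd b) = b"
      by (rule support_perm_of_cycles[OF cs(2) b(1) canonical_nonempty[OF cs(1) b(1)]])
    have "hd b \<in> set (support ?p a)"
      using support_cases[OF permn, of a "hd b"] support_nonempty(3)[OF permn, of a]
        support_nonempty(3)[OF permn, of "hd b"] b(2) unfolding sup by blast
    then have "a \<le> hd b" using a by auto
    then have "a = hd b" using canonical_hd_le[OF cs(1) b] by simp
    then show "a \<in> set (map hd cs)" using b by simp
  next
    fix a assume "a \<in> set (map hd cs)"
    then obtain b where b: "b \<in> set cs" "a = hd b" by auto
    note ne = canonical_nonempty[OF cs(1) b(1)]
    have sup: "support ?p a = b"
      unfolding b(2) by (rule support_perm_of_cycles[OF cs(2) b(1) ne])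
    have "(?p ^^ k) a \<in> set b" for k
      using support_set[OF permn, of a] unfolding sup by blast
    then have "a \<le> (?p ^^ k) a" for k
      using canonical_hd_le[OF cs(1) b(1)] b(2) by blast
    moreover have "a \<in> set (concat cs)" using b ne by (auto intro!: bexI[of _ b])
    ultimately show "a \<in> cycle_minima n ?p" using cs(3) by blast
  qed
  moreover have "sorted_list_of_set (set (map hd cs)) = map hd cs"
    using sorted_hd_canonical[OF cs(1)]
    by (simp only: sorted_list_of_set.idem_if_sorted_distinct strict_sorted_iff)
  ultimately have "standard_cycle_form n ?p = map (\<lambda>b. support ?p (hd b)) cs"
    by (simp add: standard_cycle_form_def)
  also have "\<dots> = cs"
    using support_perm_of_cycles[OF cs(2)] canonical_nonempty[OF cs(1)]
    by (intro map_idI) blast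
  finally show ?thesis .
qed

lemma bij_betw_standard_cycle_form:
  "bij_betw (standard_cycle_form n) {p. p permutes {1..n}} (canonical_forms n)"
proof (rule bij_betwI')
  fix cs assume cs: "cs \<in> canonical_forms n"
  have "perm_of_cycles cs permutes {1..n}"
    using perm_of_cycles_permutes[of cs] cs by (simp add: canonical_forms_def)
  then show "\<exists>p\<in>{p. p permutes {1..n}}. cs = standard_cycle_form n p"
    using standard_cycle_form_perm_of_cycles[OF cs] by (intro bexI[of _ "perm_of_cycles cs"]) auto
qed (use inj_on_standard_cycle_form standard_cycle_form_in_canonical_forms in
      \<open>auto simp: inj_on_def\<close>)

text \<open>A letter of a flattened permutation may open a cycle iff it is smaller than everything to its
  right. Hence \<open>weight w\<close>, which is 2 to the number of right-to-left minima of \<open>w\<close>, is the number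
  of permutations whose flattening is \<open>1 # w\<close>.\<close>

fun weight :: "nat list \<Rightarrow> nat" where
  "weight [] = 1"
| "weight (x # w) = (if \<forall>y\<in>set w. x < y then 2 else 1) * weight w"

text \<open>The first block is exempt from the canonical condition so that an induction can prepend
  arbitrary letters. For a word whose first letter is smaller than all others these are exactly the
  canonical lists of blocks.\<close>

definition splittings :: "nat list \<Rightarrow> nat list list set" where
  "splittings w = {cs. cs \<noteq> [] \<and> hd cs \<noteq> [] \<and> canonical (tl cs) \<and> concat cs = w}"

lemma canonical_hd:
  assumes "canonical cs" "concat cs = y # w"
  shows "\<forall>z\<in>set w. y < z" "cs \<in> splittings (y # w)"
proof -
  obtain b ds where cs: "cs = b # ds" using assms by (cases cs) auto
  obtain w' where b: "b = y # w'" using assms cs by (cases b) auto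
  show "\<forall>z\<in>set w. y < z" "cs \<in> splittings (y # w)"
    using assms unfolding cs b by (auto simp: splittings_def)
qed

lemma splittings_canonical:
  assumes "cs \<in> splittings (y # w)" "\<forall>z\<in>set w. y < z"
  shows "canonical cs"
proof -
  obtain b ds where cs: "cs = b # ds" using assms by (cases cs) (auto simp: splittings_def)
  obtain w' where b: "b = y # w'" using assms cs by (cases b) (auto simp: splittings_def)
  show ?thesis using assms unfolding cs b by (auto simp: splittings_def)
qed

text \<open>The letter \<open>x\<close> either joins the first block of a splitting of the rest or
  forms a block alone. In the second case \<open>y\<close> opens a later block, so it must be
  smaller than everything after it.\<close>

lemma splittings_Cons_Cons:
  "splittings (x # y # w) = (\<lambda>cs. (x # hd cs) # tl cs) ` splittings (y # w) \<union>
     (if \<forall>z\<in>set w. y < z then (\<lambda>cs. [x] # cs) ` splittings (y # w) else {})"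
  (is "?L = ?A \<union> ?B")
proof (intro equalityI subsetI)
  fix cs assume "cs \<in> ?L"
  then obtain b ds where cs: "cs = (x # b) # ds" and b: "canonical ds" "b @ concat ds = y # w"
    by (cases cs; cases "hd cs") (auto simp: splittings_def)
  show "cs \<in> ?A \<union> ?B"
  proof (cases "b = []")
    case True
    then show ?thesis using canonical_hd[of ds y w] b cs by auto
  next
    case False
    then have "cs \<in> ?A"
      using cs b by (intro image_eqI[of _ _ "b # ds"]) (auto simp: splittings_def)
    then show ?thesis by blast
  qed
next
  fix cs assume "cs \<in> ?A \<union> ?B"
  then consider ds where "cs = (x # hd ds) # tl ds" "ds \<in> splittings (y # w)"
    | ds where "cs = [x] # ds" "ds \<in> splittings (y # w)" "\<forall>z\<in>set w. y < z"
    by (auto split: if_splits)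
  then show "cs \<in> ?L"
  proof cases
    case 1
    then show ?thesis by (cases ds) (simp_all add: splittings_def)
  next
    case 2
    then show ?thesis using splittings_canonical[OF 2(2,3)] by (simp add: splittings_def)
  qed
qed

lemma card_splittings: "finite (splittings (x # w)) \<and> card (splittings (x # w)) = weight w"
proof (induction w arbitrary: x)
  case Nil
  have "splittings [x] = {[[x]]}"
  proof (intro equalityI subsetI)
    fix cs assume "cs \<in> splittings [x]"
    then obtain b ds where cs: "cs = (x # b) # ds" "b = []" "concat ds = []" "canonical ds"
      by (cases cs; cases "hd cs") (auto simp: splittings_def)
    then have "ds = []" by (cases ds) auto
    then show "cs \<in> {[[x]]}" using cs by simp
  qed (auto simp: splittings_def)
  then show ?case by simp
next
  case (Cons y w)
  let ?f = "\<lambda>cs. (x # hd cs) # tl cs" and ?h = "\<lambda>cs. [x] # cs" and ?S = "splittings (y # w)"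
  have ne: "cs \<noteq> []" "hd cs \<noteq> []" if "cs \<in> ?S" for cs using that by (auto simp: splittings_def)
  have inj: "inj_on ?f ?S" "inj_on ?h ?S"
    by (auto intro!: inj_onI intro: list.expand dest: ne)
  \<comment> \<open>The leading block has at least two letters in the first kind and exactly one in
    the second.\<close>
  have disj: "?f ` ?S \<inter> ?h ` ?S = {}" using ne by auto
  show ?case
    unfolding splittings_Cons_Cons using Cons.IH[of y] inj disj
    by (auto simp: card_image card_Un_disjoint)
qed

lemma card_permutes_flatten:
  assumes "set w = {1..n}" "distinct w" "w = 1 # w'"
  shows "card {p. p permutes {1..n} \<and> flatten n p = w} = weight w'"
proof -
  have lt: "\<forall>z\<in>set w'. 1 < z"
  proof
    fix z assume "z \<in> set w'"
    then have "z \<in> {1..n}" "z \<noteq> 1" using assms by auto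
    then show "1 < z" by auto
  qed
  let ?F = "standard_cycle_form n" and ?P = "{p. p permutes {1..n}}"
  have "?F ` {p \<in> ?P. flatten n p = w} = {cs \<in> ?F ` ?P. concat cs = w}"
    unfolding flatten_def by blast
  also have "?F ` ?P = canonical_forms n"
    using bij_betw_standard_cycle_form by (rule bij_betw_imp_surj_on)
  also have "{cs \<in> canonical_forms n. concat cs = w} = splittings (1 # w')"
  proof (intro equalityI subsetI)
    fix cs assume "cs \<in> {cs \<in> canonical_forms n. concat cs = w}"
    then show "cs \<in> splittings (1 # w')"
      using canonical_hd(2)[of cs 1 w'] assms(3) by (simp add: canonical_forms_def)
  next
    fix cs assume cs: "cs \<in> splittings (1 # w')"
    then have "concat cs = w" using assms(3) by (simp add: splittings_def)
    then show "cs \<in> {cs \<in> canonical_forms n. concat cs = w}"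
      using splittings_canonical[OF cs lt] assms(1,2) by (simp add: canonical_forms_def del: set_concat)
  qed
  finally have "card (?F ` {p \<in> ?P. flatten n p = w}) = weight w'"
    using card_splittings[of 1 w'] by simp
  moreover have "inj_on ?F {p \<in> ?P. flatten n p = w}"
    by (rule inj_on_subset[OF inj_on_standard_cycle_form]) blast
  ultimately show ?thesis
    by (simp add: card_image)
qed

section \<open>Prepending a letter to a word\<close>

text \<open>An occurrence either uses the first pair \<open>x\<close>, \<open>y\<close> as its
  ascent or lies inside \<open>y # w\<close>. Distinctness allows letters to be counted instead of
  positions.\<close>

lemma occurrences_13_2_Cons_Cons:
  assumes "distinct (x # y # w)"
  shows "occurrences_13_2 (x # y # w) = card {z \<in> set w. x < z \<and> z < y} + occurrences_13_2 (y # w)"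
proof -
  define S where "S v = {(i, j). 1 \<le> i \<and> i < j \<and> j < length v \<and> v ! (i - 1) < v ! j \<and> v ! j < v ! i}"
    for v :: "nat list"
  have fin: "finite (S v)" for v
    by (rule finite_subset[of _ "{..length v} \<times> {..length v}"]) (auto simp: S_def)
  let ?J = "{j. j < length w \<and> x < w ! j \<and> w ! j < y}"
  let ?A = "(\<lambda>j. (1::nat, Suc (Suc j))) ` ?J" and ?B = "map_prod Suc Suc ` S (y # w)"
  have "S (x # y # w) = ?A \<union> ?B"
  proof (intro equalityI subsetI)
    fix p assume p: "p \<in> S (x # y # w)"
    then obtain i j where ij: "p = (Suc i, Suc (Suc j))" "i \<le> j" "j < length w"
      "(x # y # w) ! i < w ! j" "w ! j < (y # w) ! i"
      unfolding S_def by (cases p; cases "fst p"; cases "snd p"; cases "snd p - 1") auto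
    show "p \<in> ?A \<union> ?B"
    proof (cases i)
      case 0
      then show ?thesis using ij by auto
    next
      case (Suc k)
      then have "(i, Suc j) \<in> S (y # w)" using ij by (auto simp: S_def)
      then show ?thesis using ij(1) by (auto intro!: rev_image_eqI)
    qed
  next
    fix p assume "p \<in> ?A \<union> ?B"
    then show "p \<in> S (x # y # w)"
    proof
      assume "p \<in> ?A"
      then show ?thesis by (auto simp: S_def)
    next
      assume "p \<in> ?B"
      then obtain i j where ij: "p = (Suc i, Suc j)" "(i, j) \<in> S (y # w)" by auto
      then show ?thesis by (cases i) (auto simp: S_def)
    qed
  qed
  moreover have "?A \<inter> ?B = {}" by (auto simp: S_def)
  ultimately have "card (S (x # y # w)) = card ?A + card ?B"
    using fin by (simp add: card_Un_disjoint)
  also have "card ?B = card (S (y # w))"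
    by (rule card_image) (auto intro: inj_onI)
  also have "card ?A = card ?J"
    by (rule card_image) (auto intro: inj_onI)
  also have "card ?J = card (nth w ` ?J)"
    using assms by (intro card_image[symmetric] inj_onI) (auto simp: nth_eq_iff_index_eq)
  also have "nth w ` ?J = {z \<in> set w. x < z \<and> z < y}"
    by (auto simp: in_set_conv_nth)
  finally show ?thesis
    by (simp add: occurrences_13_2_def S_def)
qed

lemma occurrences_13_2_map:
  assumes "strict_mono f"
  shows "occurrences_13_2 (map f w) = occurrences_13_2 w"
  unfolding occurrences_13_2_def
  by (rule arg_cong[of _ _ card]) (auto simp: strict_mono_less[OF assms])

lemma weight_map:
  assumes "strict_mono f"
  shows "weight (map f w) = weight w"
  by (induction w) (auto simp: strict_mono_less[OF assms])

text \<open>The increasing map whose range omits exactly \<open>i\<close>; it renames the letters of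
  a word to make room for a new letter \<open>i\<close>.\<close>

definition skip :: "nat \<Rightarrow> nat \<Rightarrow> nat" where
  "skip i y = (if y < i then y else Suc y)"

lemma strict_mono_skip: "strict_mono (skip i)"
  by (rule strict_monoI) (auto simp: skip_def)

lemma skip_image:
  assumes "1 \<le> i" "i \<le> Suc m"
  shows "skip i ` {1..m} = {1..Suc m} - {i}"
proof (intro equalityI subsetI)
  fix y assume y: "y \<in> {1..Suc m} - {i}"
  show "y \<in> skip i ` {1..m}"
  proof (cases "y < i")
    case True
    then show ?thesis using y assms by (intro rev_image_eqI[of y]) (auto simp: skip_def)
  next
    case False
    then show ?thesis using y assms by (intro rev_image_eqI[of "y - 1"]) (auto simp: skip_def)
  qed
qed (use assms in \<open>auto simp: skip_def split: if_splits\<close>)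

lemma bij_betw_prepend:
  assumes "1 \<le> i" "i \<le> Suc m"
  shows "bij_betw (\<lambda>w. i # map (skip i) w) (permutations_of_set {1..m})
           {w \<in> permutations_of_set {1..Suc m}. hd w = i}"
proof -
  have inj: "inj (skip i)" using strict_mono_skip by (rule strict_mono_imp_inj_on)
  show ?thesis
  proof (rule bij_betw_imageI)
    show "inj_on (\<lambda>w. i # map (skip i) w) (permutations_of_set {1..m})"
      using inj by (auto intro!: inj_onI simp: inj_map_eq_map)
    show "(\<lambda>w. i # map (skip i) w) ` permutations_of_set {1..m} =
        {w \<in> permutations_of_set {1..Suc m}. hd w = i}"
    proof (intro equalityI subsetI)
      fix w assume "w \<in> (\<lambda>w. i # map (skip i) w) ` permutations_of_set {1..m}"
      then obtain v where v: "w = i # map (skip i) v" "set v = {1..m}" "distinct v"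
        by (auto simp: permutations_of_set_def)
      have "set w = insert i ({1..Suc m} - {i})"
        using v skip_image[OF assms] by simp
      moreover have "i \<in> {1..Suc m}" using assms by simp
      ultimately have "set w = {1..Suc m}" by (simp only: insert_Diff)
      moreover have "distinct w"
        using v(2,3) skip_image[OF assms] inj_on_subset[OF inj, of "{1..m}"]
        unfolding v(1) by (simp only: distinct.simps distinct_map list.set_map) simp
      ultimately show "w \<in> {w \<in> permutations_of_set {1..Suc m}. hd w = i}"
        using v(1) by (simp add: permutations_of_set_def)
    next
      fix w assume "w \<in> {w \<in> permutations_of_set {1..Suc m}. hd w = i}"
      then have w: "set w = {1..Suc m}" "distinct w" "hd w = i"
        by (auto simp: permutations_of_set_def)
      have "w \<noteq> []" using w(1) by auto
      then obtain u where u: "w = i # u" using w(3) by (cases w) auto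
      then have "set u = skip i ` {1..m}"
        using w skip_image[OF assms] by auto
      then have "set u \<subseteq> range (skip i)" by auto
      then obtain v where v: "u = map (skip i) v"
        by (metis ex_map_conv subsetD rangeE)
      have "set v = {1..m}"
        using \<open>set u = _\<close> unfolding v by (simp add: inj_image_eq_iff[OF inj])
      moreover have "distinct v" using w(2) unfolding u v by (simp add: distinct_map)
      ultimately have "v \<in> permutations_of_set {1..m}" by (simp add: permutations_of_set_def)
      then show "w \<in> (\<lambda>w. i # map (skip i) w) ` permutations_of_set {1..m}"
        unfolding u v by (rule imageI)
    qed
  qed
qed

text \<open>With \<open>j = hd w\<close>, a new occurrence needs a letter strictly between
  \<open>i\<close> and \<open>skip i j\<close>. For \<open>i < j\<close> these letters are
  \<open>i + 1\<close> up to \<open>j\<close>; otherwise there is none. Truncated subtraction covers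
  both cases.\<close>

lemma occurrences_13_2_prepend:
  assumes "1 \<le> i" "i \<le> Suc m" "w \<in> permutations_of_set {1..m}" "m \<ge> 1"
  shows "occurrences_13_2 (i # map (skip i) w) = (hd w - i) + occurrences_13_2 w"
proof -
  have w: "set w = {1..m}" "distinct w" using assms(3) by (auto simp: permutations_of_set_def)
  have "w \<noteq> []" using w(1) assms(4) by auto
  then obtain j u where u: "w = j # u" by (cases w) auto
  have set_u: "set u = {1..m} - {j}" and "j \<in> {1..m}" using w unfolding u by auto
  have "{z \<in> set (map (skip i) u). i < z \<and> z < skip i j} = Suc ` {i..<j}"
  proof (intro equalityI subsetI)
    fix z assume "z \<in> {z \<in> set (map (skip i) u). i < z \<and> z < skip i j}"
    then show "z \<in> Suc ` {i..<j}"
      unfolding set_map set_u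
      by (intro rev_image_eqI[of "z - 1"]) (auto simp: skip_def split: if_splits)
  next
    fix z assume "z \<in> Suc ` {i..<j}"
    then obtain y where y: "z = Suc y" "i \<le> y" "y < j" by (elim imageE) auto
    then have "y \<in> set u" and "z = skip i y"
      using \<open>j \<in> {1..m}\<close> assms(1) unfolding set_u by (auto simp: skip_def)
    then show "z \<in> {z \<in> set (map (skip i) u). i < z \<and> z < skip i j}"
      using y by (auto simp: skip_def)
  qed
  then have card: "card {z \<in> set (map (skip i) u). i < z \<and> z < skip i j} = j - i"
    by (simp add: card_image)
  have "i # map (skip i) w \<in> {w \<in> permutations_of_set {1..Suc m}. hd w = i}"
    using bij_betw_apply[OF bij_betw_prepend[OF assms(1,2)] assms(3)] .
  then have "distinct (i # skip i j # map (skip i) u)"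
    by (simp add: permutations_of_set_def u)
  from occurrences_13_2_Cons_Cons[OF this] show ?thesis
    using card occurrences_13_2_map[OF strict_mono_skip, of i w] by (simp add: u)
qed

section \<open>Weighted word counts and their recurrence\<close>

definition word_count :: "nat \<Rightarrow> nat \<Rightarrow> nat \<Rightarrow> nat" where
  "word_count m s i =
     (\<Sum>w | w \<in> permutations_of_set {1..m} \<and> hd w = i \<and> occurrences_13_2 w = s. weight w)"

text \<open>The words are grouped by their first letter \<open>j\<close>. The test
  \<open>j - i \<le> s\<close> excludes the letters for which \<open>s - (j - i)\<close> would be
  truncated.\<close>

lemma sum_words_hd:
  assumes "m \<ge> 1"
  shows "(\<Sum>w | w \<in> permutations_of_set {1..m} \<and> (hd w - i) + occurrences_13_2 w = s. weight w) =
         (\<Sum>j = 1..m. if j - i \<le> s then word_count m (s - (j - i)) j else 0)"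
proof -
  let ?W = "{w \<in> permutations_of_set {1..m}. (hd w - i) + occurrences_13_2 w = s}"
  have "hd ` ?W \<subseteq> {1..m}"
  proof
    fix j assume "j \<in> hd ` ?W"
    then obtain w where "j = hd w" "set w = {1..m}" by (auto simp: permutations_of_set_def)
    moreover have "w \<noteq> []" using \<open>set w = {1..m}\<close> assms by auto
    ultimately show "j \<in> {1..m}" by (metis hd_in_set)
  qed
  then have "(\<Sum>w\<in>?W. weight w) = (\<Sum>j = 1..m. \<Sum>w | w \<in> ?W \<and> hd w = j. weight w)"
    by (intro sum.group[symmetric]) auto
  also have "\<dots> = (\<Sum>j = 1..m. if j - i \<le> s then word_count m (s - (j - i)) j else 0)"
  proof (rule sum.cong[OF refl])
    fix j
    have "{w. w \<in> ?W \<and> hd w = j} = (if j - i \<le> s then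
        {w. w \<in> permutations_of_set {1..m} \<and> hd w = j \<and> occurrences_13_2 w = s - (j - i)} else {})"
      by auto
    then show "(\<Sum>w | w \<in> ?W \<and> hd w = j. weight w) =
        (if j - i \<le> s then word_count m (s - (j - i)) j else 0)"
      by (simp add: word_count_def)
  qed
  finally show ?thesis by simp
qed

text \<open>This comes from deleting the first letter \<open>i\<close>, which is a right-to-left
  minimum exactly when \<open>i = 1\<close>; hence the factor 2.\<close>

lemma word_count_Suc:
  assumes "m \<ge> 1" "1 \<le> i" "i \<le> Suc m"
  shows "word_count (Suc m) s i = (if i = 1 then 2 else 1) *
           (\<Sum>j = 1..m. if j - i \<le> s then word_count m (s - (j - i)) j else 0)"
proof -
  let ?f = "\<lambda>w. i # map (skip i) w"
  let ?W = "{w \<in> permutations_of_set {1..m}. (hd w - i) + occurrences_13_2 w = s}"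
  have "bij_betw ?f ?W
      {w \<in> permutations_of_set {1..Suc m}. hd w = i \<and> occurrences_13_2 w = s}"
  proof (rule bij_betw_subset[OF bij_betw_prepend[OF assms(2,3)]])
    have "?f ` ?W = {w \<in> ?f ` permutations_of_set {1..m}. occurrences_13_2 w = s}"
      using occurrences_13_2_prepend[OF assms(2,3) _ assms(1)] by auto
    also have "?f ` permutations_of_set {1..m} = {w \<in> permutations_of_set {1..Suc m}. hd w = i}"
      by (rule bij_betw_imp_surj_on[OF bij_betw_prepend[OF assms(2,3)]])
    finally show "?f ` ?W = {w \<in> permutations_of_set {1..Suc m}. hd w = i \<and> occurrences_13_2 w = s}"
      by blast
  qed blast
  then have "word_count (Suc m) s i = (\<Sum>w\<in>?W. weight (?f w))"
    unfolding word_count_def by (rule sum.reindex_bij_betw[symmetric])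
  also have "\<dots> = (\<Sum>w\<in>?W. (if i = 1 then 2 else 1) * weight w)"
  proof (rule sum.cong[OF refl])
    fix w assume "w \<in> ?W"
    then have w: "set w = {1..m}" by (simp add: permutations_of_set_def)
    have "(\<forall>y\<in>skip i ` {1..m}. i < y) \<longleftrightarrow> i = 1"
    proof
      assume "\<forall>y\<in>skip i ` {1..m}. i < y"
      then have "i < skip i 1" using assms(1) by auto
      then show "i = 1" using assms(2) by (simp add: skip_def split: if_splits)
    qed (simp add: skip_def)
    then show "weight (?f w) = (if i = 1 then 2 else 1) * weight w"
      using w by (simp add: weight_map[OF strict_mono_skip])
  qed
  also have "\<dots> = (if i = 1 then 2 else 1) * (\<Sum>w\<in>?W. weight w)"
    by (simp add: sum_distrib_left)
  finally show ?thesis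
    using sum_words_hd[OF assms(1), of i s] by simp
qed

lemma word_count_1: "word_count (Suc 0) s i = (if s = 0 \<and> i = 1 then 2 else 0)"
proof -
  have "occurrences_13_2 [1] = 0" by (simp add: occurrences_13_2_def cong: conj_cong)
  then have "{w. w \<in> permutations_of_set {1..Suc 0} \<and> hd w = i \<and> occurrences_13_2 w = s} =
      (if s = 0 \<and> i = 1 then {[1]} else {})"
    by auto
  then show ?thesis by (simp add: word_count_def)
qed

lemma word_count_eq_0:
  assumes "1 \<le> m" "m < i"
  shows "word_count m s i = 0"
proof -
  have "hd w \<le> m" if "w \<in> permutations_of_set {1..m}" for w
  proof -
    have w: "set w = {1..m}" using that by (simp add: permutations_of_set_def)
    then have "w \<noteq> []" using assms(1) by auto
    then show ?thesis using w hd_in_set by fastforce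
  qed
  then have "{w. w \<in> permutations_of_set {1..m} \<and> hd w = i \<and> occurrences_13_2 w = s} = {}"
    using assms by fastforce
  then show ?thesis by (simp only: word_count_def sum.empty)
qed

text \<open>Deleting the leading 1 lowers all other letters by one, so the new first letter is
  \<open>i - 1\<close>, and destroys \<open>i - 2\<close> occurrences. The weights count the
  permutations that share a flattening.\<close>

lemma g_eq_word_count:
  assumes "2 \<le> i" "i \<le> n"
  shows "g n r i = (if i - 2 \<le> r then word_count (n - 1) (r - (i - 2)) (i - 1) else 0)"
proof -
  obtain m where n: "n = Suc m" and m: "m \<ge> 1" using assms by (cases n) auto
  let ?W = "{w \<in> permutations_of_set {1..m}. hd w = i - 1 \<and> (hd w - 1) + occurrences_13_2 w = r}"
  let ?f = "\<lambda>w. 1 # map (skip 1) w"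
  let ?P = "{w \<in> permutations_of_set {1..n}. take 2 w = [1, i] \<and> occurrences_13_2 w = r}"
  have "bij_betw ?f ?W ?P"
  proof (rule bij_betw_subset[OF bij_betw_prepend])
    have take: "take 2 (?f w) = [1, i] \<longleftrightarrow> hd w = i - 1"
      if "w \<in> permutations_of_set {1..m}" for w
    proof -
      have w: "set w = {1..m}" using that by (simp add: permutations_of_set_def)
      then have "w \<noteq> []" using m by auto
      then obtain j u where u: "w = j # u" by (cases w) auto
      then have "j \<ge> 1" using w by auto
      then show ?thesis unfolding u using assms(1) by (auto simp: skip_def numeral_2_eq_2)
    qed
    have "?f ` ?W = {w \<in> ?f ` permutations_of_set {1..m}. take 2 w = [1, i] \<and> occurrences_13_2 w = r}"
      using take occurrences_13_2_prepend[OF order.refl _ _ m] m by auto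
    also have "?f ` permutations_of_set {1..m} = {w \<in> permutations_of_set {1..Suc m}. hd w = 1}"
      by (rule bij_betw_imp_surj_on[OF bij_betw_prepend]) auto
    finally show "?f ` ?W = ?P"
      unfolding n by (auto simp: numeral_2_eq_2 hd_conv_nth dest: arg_cong[of _ _ hd])
  qed (use m in auto)
  have "{p. p permutes {1..n} \<and> take 2 (flatten n p) = [1, i] \<and> occurrences_13_2 (flatten n p) = r} =
      (\<Union>w\<in>?P. {p. p permutes {1..n} \<and> flatten n p = w})"
  proof -
    have "flatten n p \<in> permutations_of_set {1..n}" if "p permutes {1..n}" for p
      using standard_cycle_form_in_canonical_forms[OF that]
      by (simp add: flatten_def canonical_forms_def permutations_of_set_def)
    then show ?thesis by blast
  qed
  then have "g n r i = card (\<Union>w\<in>?P. {p. p permutes {1..n} \<and> flatten n p = w})"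
    by (simp add: g_def)
  also have "\<dots> = (\<Sum>w\<in>?P. card {p. p permutes {1..n} \<and> flatten n p = w})"
    by (rule card_UN_disjoint) (auto intro: finite_subset[OF _ finite_permutations])
  also have "\<dots> = (\<Sum>w\<in>?P. weight (tl w))"
  proof (rule sum.cong[OF refl])
    fix w assume w: "w \<in> ?P"
    then have "w = 1 # tl w" by (cases w) auto
    then show "card {p. p permutes {1..n} \<and> flatten n p = w} = weight (tl w)"
      using w by (intro card_permutes_flatten) (auto simp: permutations_of_set_def)
  qed
  also have "\<dots> = (\<Sum>w\<in>?W. weight (tl (?f w)))"
    using \<open>bij_betw ?f ?W ?P\<close> by (rule sum.reindex_bij_betw[symmetric])
  also have "\<dots> = (\<Sum>w\<in>?W. weight w)"
    by (simp add: weight_map[OF strict_mono_skip])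
  also have "?W = (if i - 2 \<le> r then {w \<in> permutations_of_set {1..m}. hd w = i - 1 \<and>
      occurrences_13_2 w = r - (i - 2)} else {})"
    using assms by auto
  finally show ?thesis
    by (simp add: word_count_def n)
qed

section \<open>Generating functions\<close>

definition denom :: "nat \<Rightarrow> nat \<Rightarrow> rat poly" where
  "denom a b = [:1, -1:] ^ a * [:1, -2:] ^ b"

lemma fps_of_poly_denom: "fps_of_poly (denom a b) = (1 - fps_X) ^ a * (1 - 2 * fps_X) ^ b"
proof -
  have "fps_of_poly [:1, -1 :: rat:] = 1 - fps_X"
    by (simp add: fps_of_poly_linear')
  moreover have "fps_of_poly [:1, -2 :: rat:] = 1 - 2 * fps_X"
    by (simp add: fps_of_poly_linear' fps_numeral_fps_const flip: fps_const_neg)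
  ultimately show ?thesis
    by (simp only: denom_def fps_of_poly_mult fps_of_poly_power)
qed

lemma denom_add: "denom (a + a') (b + b') = denom a b * denom a' b'"
  by (simp add: denom_def power_add)

lemma degree_denom: "degree (denom a b) = a + b"
  by (simp add: denom_def degree_mult_eq degree_power_eq)

lemma lead_coeff_denom: "coeff (denom a b) (a + b) = (-1) ^ a * (-2) ^ b"
  using lead_coeff_mult[of "[:1, -1::rat:] ^ a" "[:1, -2:] ^ b"]
  by (simp add: lead_coeff_power degree_denom flip: denom_def)

lemma coeff_denom_eq_0: "k > a + b \<Longrightarrow> coeff (denom a b) k = 0"
  by (simp add: coeff_eq_0 degree_denom)

lemma coeff_0_denom: "coeff (denom a b) 0 = 1"
  by (simp add: denom_def coeff_mult_0 coeff_0_power)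

lemma poly_denom_half: "poly (denom a b) (1/2) = (1/2) ^ a * 0 ^ b"
  by (simp add: denom_def)

text \<open>\<open>F\<close> is a proper rational function with denominator
  \<open>denom a b\<close>. The number \<open>y\<close> is the value at 1/2 of the numerator
  belonging to these exponents, so it changes when they change.\<close>

definition proper_form :: "nat \<Rightarrow> nat \<Rightarrow> rat fps \<Rightarrow> rat \<Rightarrow> bool" where
  "proper_form a b F y \<longleftrightarrow> (\<exists>p. fps_of_poly (denom a b) * F = fps_of_poly p \<and>
     (\<forall>k \<ge> a + b. coeff p k = 0) \<and> poly p (1/2) = y)"

text \<open>Each extra factor \<open>1 - x\<close> contributes 1/2 to the value of the numerator at
  1/2, and each extra \<open>1 - 2x\<close> contributes 0. The convention \<open>0 ^ 0 = 1\<close>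
  covers \<open>b' = b\<close>.\<close>

lemma proper_form_weaken:
  assumes "proper_form a b F y" "a \<le> a'" "b \<le> b'"
  shows "proper_form a' b' F (y * (1/2) ^ (a' - a) * 0 ^ (b' - b))"
proof -
  obtain p where p: "fps_of_poly (denom a b) * F = fps_of_poly p"
    "\<forall>k \<ge> a + b. coeff p k = 0" "poly p (1/2) = y"
    using assms(1) by (auto simp: proper_form_def)
  let ?q = "denom (a' - a) (b' - b)"
  have "denom a' b' = denom a b * ?q"
    using denom_add[of a "a' - a" b "b' - b"] assms(2,3) by simp
  then have "fps_of_poly (denom a' b') * F = fps_of_poly (p * ?q)"
    by (simp add: fps_of_poly_mult p(1)[symmetric] mult_ac)
  moreover have "coeff (p * ?q) k = 0" if "k \<ge> a' + b'" for k
  proof -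
    have "coeff p i * coeff ?q (k - i) = 0" if "i \<le> k" for i
    proof (cases "a + b \<le> i")
      case True
      then show ?thesis using p(2) by simp
    next
      case False
      then have "k - i > (a' - a) + (b' - b)" using \<open>k \<ge> a' + b'\<close> assms(2,3) by linarith
      then show ?thesis by (simp add: coeff_denom_eq_0)
    qed
    then show ?thesis unfolding coeff_mult by (intro sum.neutral ballI) (simp only: atMost_iff)
  qed
  moreover have "poly (p * ?q) (1/2) = y * (1/2) ^ (a' - a) * 0 ^ (b' - b)"
    by (simp add: p(3) poly_denom_half)
  ultimately show ?thesis unfolding proper_form_def by blast
qed

lemma proper_form_0: "proper_form a b 0 0"
  unfolding proper_form_def by (intro exI[of _ 0]) simp

lemma proper_form_add:
  assumes "proper_form a b F y" "proper_form a b F' y'"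
  shows "proper_form a b (F + F') (y + y')"
proof -
  obtain p p' where p: "fps_of_poly (denom a b) * F = fps_of_poly p"
    "\<forall>k \<ge> a + b. coeff p k = 0" "poly p (1/2) = y"
    and p': "fps_of_poly (denom a b) * F' = fps_of_poly p'"
    "\<forall>k \<ge> a + b. coeff p' k = 0" "poly p' (1/2) = y'"
    using assms by (auto simp: proper_form_def)
  then show ?thesis
    unfolding proper_form_def
    by (intro exI[of _ "p + p'"]) (simp add: fps_of_poly_add distrib_left)
qed

lemma proper_form_sum:
  assumes "\<And>j. j \<in> J \<Longrightarrow> proper_form a b (F j) (y j)"
  shows "proper_form a b (sum F J) (sum y J)"
  using assms by (induction J rule: infinite_finite_induct) (auto intro: proper_form_0 proper_form_add)

text \<open>The coefficients of the expansion at infinity continue those of the power series backwards,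
  so the leading coefficient of the shifted numerator is the coefficient that has been removed.\<close>

lemma proper_form_shift_leading:
  assumes "proper_form a b F y" "b \<ge> 1"
  obtains p where "fps_of_poly (denom a b) * fps_shift 1 F = fps_of_poly p"
    "\<forall>k \<ge> a + b. coeff p k = 0" "poly p (1/2) = 2 * y"
    "coeff p (a + b - 1) = - ((-1) ^ a * (-2) ^ b * fps_nth F 0)"
proof -
  obtain p where p: "fps_of_poly (denom a b) * F = fps_of_poly p"
    "\<forall>k \<ge> a + b. coeff p k = 0" "poly p (1/2) = y"
    using assms by (auto simp: proper_form_def)
  let ?c = "fps_nth F 0"
  \<comment> \<open>Removing the constant term of \<open>F\<close> turns the numerator into
    \<open>p - smult ?c (denom a b)\<close>, which is divisible by x with quotient
    \<open>q\<close>.\<close>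
  obtain c0 q where q: "p - smult ?c (denom a b) = pCons c0 q" by (rule pCons_cases)
  have "fps_nth (fps_of_poly (denom a b) * F) 0 = ?c"
    by (simp add: coeff_0_denom)
  then have "coeff p 0 = ?c" unfolding p(1) by simp
  then have "c0 = 0"
    using arg_cong[OF q, of "\<lambda>p. coeff p 0"] by (simp add: coeff_0_denom)
  have F: "F = fps_const ?c + fps_X * fps_shift 1 F"
    by (rule fps_ext) (simp add: fps_X_mult_nth)
  have "fps_X * (fps_of_poly (denom a b) * fps_shift 1 F) =
      fps_of_poly (denom a b) * F - fps_of_poly (denom a b) * fps_const ?c"
    by (subst (2) F) (simp add: algebra_simps)
  also have "\<dots> = fps_of_poly (pCons 0 q)"
    unfolding p(1) q[unfolded \<open>c0 = 0\<close>, symmetric]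
    by (simp add: fps_of_poly_diff fps_of_poly_smult mult.commute)
  also have "\<dots> = fps_X * fps_of_poly q"
    by (simp add: fps_of_poly_pCons mult.commute)
  finally have 1: "fps_of_poly (denom a b) * fps_shift 1 F = fps_of_poly q"
    by simp
  have coeff: "coeff q k = coeff p (Suc k) - ?c * coeff (denom a b) (Suc k)" for k
    using arg_cong[OF q, of "\<lambda>p. coeff p (Suc k)"] by simp
  have 2: "\<forall>k \<ge> a + b. coeff q k = 0"
    using p(2) by (simp add: coeff coeff_denom_eq_0)
  \<comment> \<open>Since \<open>b \<ge> 1\<close>, \<open>denom a b\<close> vanishes at 1/2. Thus x
    times \<open>q\<close> has value \<open>y\<close> there, and \<open>q\<close> has value
    \<open>2 * y\<close>.\<close>
  have "poly (p - smult ?c (denom a b)) (1/2) = y"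
    using assms(2) by (simp add: p(3) poly_denom_half)
  then have 3: "poly q (1/2) = 2 * y"
    unfolding q by (simp add: \<open>c0 = 0\<close>)
  \<comment> \<open>The coefficient of \<open>p\<close> in degree \<open>a + b\<close> is 0, so only
    \<open>denom a b\<close> contributes.\<close>
  have 4: "coeff q (a + b - 1) = - ((-1) ^ a * (-2) ^ b * ?c)"
    using assms(2) p(2) by (simp add: coeff lead_coeff_denom)
  show thesis by (rule that[OF 1 2 3 4])
qed

lemma proper_form_shift:
  assumes "proper_form a b F y" "b \<ge> 1"
  shows "proper_form a b (fps_shift d F) (2 ^ d * y)"
proof (induction d)
  case 0
  then show ?case using assms(1) by simp
next
  case (Suc d)
  from proper_form_shift_leading[OF this assms(2)]
  have "proper_form a b (fps_shift 1 (fps_shift d F)) (2 * (2 ^ d * y))"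
    unfolding proper_form_def by metis
  moreover have "fps_shift 1 (fps_shift d F) = fps_shift (Suc d) F"
    by (rule fps_ext) simp
  ultimately show ?case by (simp only: power_Suc mult.assoc)
qed

text \<open>Collecting \<open>F\<close> on the left gives a factor \<open>1 - x\<close>, and the
  numerator becomes \<open>e\<close> times \<open>denom a b\<close> plus x times \<open>p\<close>.
  At 1/2 the first term vanishes and the second is halved.\<close>

lemma proper_form_solve_1:
  assumes "F = fps_const e + fps_X * (S + F)" "proper_form a b S y" "b \<ge> 1"
  shows "proper_form (Suc a) b F (y / 2)"
proof -
  obtain p where p: "fps_of_poly (denom a b) * S = fps_of_poly p"
    "\<forall>k \<ge> a + b. coeff p k = 0" "poly p (1/2) = y"
    using assms(2) by (auto simp: proper_form_def)
  have "(1 - fps_X) * F = fps_const e + fps_X * S"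
    using assms(1) by (simp add: algebra_simps)
  moreover have "fps_of_poly (denom (Suc a) b) * F = fps_of_poly (denom a b) * ((1 - fps_X) * F)"
    by (simp add: fps_of_poly_denom mult_ac)
  ultimately have "fps_of_poly (denom (Suc a) b) * F =
      fps_of_poly (denom a b) * fps_const e + fps_X * (fps_of_poly (denom a b) * S)"
    by (simp add: distrib_left mult_ac)
  also have "\<dots> = fps_of_poly (smult e (denom a b) + pCons 0 p)"
    unfolding p(1) by (simp add: fps_of_poly_add fps_of_poly_smult fps_of_poly_pCons mult.commute)
  finally show ?thesis
    unfolding proper_form_def using p(2,3) assms(3)
    by (intro exI[of _ "smult e (denom a b) + pCons 0 p"])
       (auto simp: coeff_denom_eq_0 poly_denom_half coeff_pCons split: nat.split)
qed

text \<open>The same argument produces a factor \<open>1 - 2x\<close>; since 2x equals 1 at 1/2, the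
  value is kept.\<close>

lemma proper_form_solve_2:
  assumes "F = fps_const e + 2 * fps_X * (S + F)" "proper_form a b S y" "b \<ge> 1"
  shows "proper_form a (Suc b) F y"
proof -
  obtain p where p: "fps_of_poly (denom a b) * S = fps_of_poly p"
    "\<forall>k \<ge> a + b. coeff p k = 0" "poly p (1/2) = y"
    using assms(2) by (auto simp: proper_form_def)
  have "(1 - 2 * fps_X) * F = fps_const e + 2 * fps_X * S"
    using assms(1) by (simp add: algebra_simps)
  moreover have "fps_of_poly (denom a (Suc b)) * F = fps_of_poly (denom a b) * ((1 - 2 * fps_X) * F)"
    by (simp add: fps_of_poly_denom mult_ac)
  ultimately have "fps_of_poly (denom a (Suc b)) * F =
      fps_of_poly (denom a b) * fps_const e + 2 * (fps_X * (fps_of_poly (denom a b) * S))"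
    by (simp add: distrib_left mult_ac)
  also have "\<dots> = fps_of_poly (smult e (denom a b) + smult 2 (pCons 0 p))"
    unfolding p(1)
    by (simp add: fps_of_poly_add fps_of_poly_smult fps_of_poly_pCons mult.commute fps_numeral_fps_const)
  finally show ?thesis
    unfolding proper_form_def using p(2,3) assms(3)
    by (intro exI[of _ "smult e (denom a b) + smult 2 (pCons 0 p)"])
       (auto simp: coeff_denom_eq_0 poly_denom_half coeff_pCons split: nat.split)
qed

section \<open>Solving the recurrence level by level\<close>

text \<open>The level \<open>r\<close> is the number of occurrences plus the first letter minus 1.
  Summands with \<open>j \<ge> i\<close> stay on level \<open>r\<close>; those with
  \<open>j < i\<close> keep the number of occurrences and fall to level
  \<open>r - (i - j)\<close>.\<close>

lemma word_count_level_Suc: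
  assumes "1 \<le> r" "r \<le> n" "1 \<le> i" "i \<le> r + 1"
  shows "word_count (Suc n) (r + 1 - i) i = (if i = 1 then 2 else 1) *
    ((\<Sum>j = 1..<i. word_count n (r - (i - j) + 1 - j) j) + (\<Sum>j = i..r + 1. word_count n (r + 1 - j) j))"
proof -
  let ?F = "\<lambda>j. if j - i \<le> r + 1 - i then word_count n (r + 1 - i - (j - i)) j else 0"
  \<comment> \<open>Letters above \<open>n\<close> contribute 0 and letters above
    \<open>r + 1\<close> fail the test, so both ranges can be compared with a common larger
    one.\<close>
  have "sum ?F {1..n} = sum ?F {1..n + r + 1}"
    using assms by (intro sum.mono_neutral_left) (auto simp: word_count_eq_0)
  also have "\<dots> = sum ?F {1..r + 1}"
    using assms by (intro sum.mono_neutral_right) auto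
  also have "{1..r + 1} = {1..<i} \<union> {i..r + 1}"
    using assms by auto
  also have "sum ?F \<dots> = sum ?F {1..<i} + sum ?F {i..r + 1}"
    by (rule sum.union_disjoint) auto
  also have "sum ?F {1..<i} = (\<Sum>j = 1..<i. word_count n (r - (i - j) + 1 - j) j)"
    using assms by (intro sum.cong refl) (auto intro!: arg_cong2[of _ _ _ _ "word_count n"])
  also have "sum ?F {i..r + 1} = (\<Sum>j = i..r + 1. word_count n (r + 1 - j) j)"
    using assms by (intro sum.cong refl) auto
  finally have "sum ?F {1..n} = (\<Sum>j = 1..<i. word_count n (r - (i - j) + 1 - j) j) +
      (\<Sum>j = i..r + 1. word_count n (r + 1 - j) j)" .
  moreover have "1 \<le> n" "i \<le> Suc n" using assms by auto
  ultimately show ?thesis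
    using word_count_Suc[of n i "r + 1 - i"] assms(3) by (simp only:)
qed

text \<open>Starting at length \<open>r + 1\<close> instead of \<open>r + 2\<close> adds to the series occurring in \<open>G r\<close> one more
  constant term, which is also the value that the recurrence predicts when run backwards.\<close>

definition word_series :: "nat \<Rightarrow> nat \<Rightarrow> rat fps" where
  "word_series r i = Abs_fps (\<lambda>m. of_nat (word_count (r + 1 + m) (r + 1 - i) i))"

text \<open>A series of level \<open>r - (i - j)\<close> starts \<open>i - j\<close> lengths
  earlier, hence the shift. The summand \<open>word_series r i\<close> stands apart to fit
  \<open>proper_form_solve_1\<close> and \<open>proper_form_solve_2\<close>.\<close>

lemma word_series_rec:
  assumes "1 \<le> r" "1 \<le> i" "i \<le> r + 1"
  shows "word_series r i = fps_const (of_nat (word_count (r + 1) (r + 1 - i) i)) +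
    (if i = 1 then 2 else 1) * fps_X *
    (((\<Sum>j = 1..<i. fps_shift (i - j) (word_series (r - (i - j)) j)) +
      (\<Sum>j = Suc i..r + 1. word_series r j)) + word_series r i)"
    (is "_ = ?e + ?k * fps_X * (?S + _)")
proof (rule fps_ext)
  fix m
  have *: "fps_nth (?S + word_series r i) m' = of_nat
      ((\<Sum>j = 1..<i. word_count (r + 1 + m') (r - (i - j) + 1 - j) j) +
       (\<Sum>j = i..r + 1. word_count (r + 1 + m') (r + 1 - j) j))" for m'
  proof -
    have "fps_nth (fps_shift (i - j) (word_series (r - (i - j)) j)) m' =
        of_nat (word_count (r + 1 + m') (r - (i - j) + 1 - j) j)" if "j \<in> {1..<i}" for j
    proof -
      have "r - (i - j) + 1 + (m' + (i - j)) = r + 1 + m'" using that assms by auto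
      then show ?thesis by (simp add: word_series_def)
    qed
    moreover have "{i..r + 1} = insert i {Suc i..r + 1}" using assms by auto
    ultimately show ?thesis
      by (simp add: fps_sum_nth word_series_def)
  qed
  have k: "fps_nth (?k * fps_X * H) (Suc m') = (if i = 1 then 2 else 1) * fps_nth H m'" for H :: "rat fps" and m'
    by (simp add: mult.assoc fps_X_mult_nth numeral_fps_const)
  show "fps_nth (word_series r i) m = fps_nth (?e + ?k * fps_X * (?S + word_series r i)) m"
  proof (cases m)
    case 0
    then show ?thesis by (simp add: word_series_def)
  next
    case (Suc m')
    have "fps_nth (?e + ?k * fps_X * (?S + word_series r i)) m =
        (if i = 1 then 2 else 1) * fps_nth (?S + word_series r i) m'"
      unfolding Suc using k[of "?S + word_series r i" m'] by simp
    also have "\<dots> = of_nat (word_count (Suc (r + 1 + m')) (r + 1 - i) i)"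
      unfolding * using assms by (subst word_count_level_Suc) auto
    finally show ?thesis by (simp add: word_series_def Suc)
  qed
qed

lemma word_count_0_1: "word_count (Suc m) 0 1 = 2 ^ Suc m"
proof (induction m)
  case 0
  then show ?case by (simp add: word_count_1)
next
  case (Suc m)
  have "word_count (Suc (Suc m)) 0 1 = 2 * (\<Sum>j = 1..Suc m. if j - 1 \<le> 0 then word_count (Suc m) 0 j else 0)"
    by (subst word_count_Suc) (auto intro!: sum.cong)
  also have "(\<Sum>j = 1..Suc m. if j - 1 \<le> 0 then word_count (Suc m) 0 j else 0) =
      (\<Sum>j\<in>{1}. word_count (Suc m) 0 j)"
    by (rule sum.mono_neutral_cong_right) auto
  finally show ?case using Suc by simp
qed

lemma word_series_0: "proper_form 0 1 (word_series 0 1) 2"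
proof -
  have "(1 - 2 * fps_X) * word_series 0 1 = fps_const 2"
    by (rule fps_ext)
       (auto simp: word_series_def word_count_0_1[simplified] algebra_simps fps_X_mult_nth
         numeral_fps_const simp flip: power_Suc split: nat.splits)
  then show ?thesis
    unfolding proper_form_def
    by (intro exI[of _ "[:2:]"]) (auto simp: fps_of_poly_denom coeff_pCons fps_of_poly_const split: nat.split)
qed

text \<open>Exponent of \<open>1 - x\<close> in the denominator of \<open>word_series r i\<close>,
  while \<open>order_2\<close> is that of \<open>1 - 2x\<close>. At \<open>r = 0\<close>,
  \<open>i = 1\<close> truncation yields the correct exponent 0.\<close>

definition order_1 :: "nat \<Rightarrow> nat \<Rightarrow> nat" where
  "order_1 r i = (if i = 1 then 2 * r - 1 else 2 * r + 1 - i)"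

definition order_2 :: "nat \<Rightarrow> nat \<Rightarrow> nat" where
  "order_2 r i = (if i = 1 then r + 1 else r + 2 - i)"

text \<open>A spare factor \<open>1 - 2x\<close> kills the value at 1/2, so in a sum only the terms
  with the full power of it contribute.\<close>

lemma proper_form_weaken_0:
  assumes "proper_form a b F y" "a \<le> a'" "b < b'"
  shows "proper_form a' b' F 0"
  using proper_form_weaken[OF assms(1,2) less_imp_le[OF assms(3)]] assms(3)
  by (simp add: power_0_left)

text \<open>The induction runs over the levels and, inside a level, downwards from
  \<open>i = r + 1\<close> to 2, with \<open>i = 1\<close> last. The value at 1/2 passes from
  \<open>i = 1\<close> on level \<open>r - 1\<close> to \<open>i = 2\<close> and then to
  \<open>i = 1\<close> on level \<open>r\<close>.\<close>

lemma proper_form_word_series: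
  assumes "i \<in> {1..r + 1}"
  shows "\<exists>y. proper_form (order_1 r i) (order_2 r i) (word_series r i) y \<and>
           (i = 1 \<longrightarrow> y = 2 * (1/2) ^ (r - 1))"
  using assms
proof (induction r arbitrary: i rule: less_induct)
  case (less r)
  show ?case
  proof (cases "r = 0")
    case True
    then show ?thesis using less.prems word_series_0 by (auto simp: order_1_def order_2_def)
  next
    case False
    then have r: "r \<ge> 1" by simp
    note IH = less.IH
    have step: "\<exists>y. proper_form (2 * r + 1 - i) (r + 2 - i) (word_series r i) y \<and>
        (i = 2 \<longrightarrow> y = 2 * (1/2) ^ (r - 1))" if "i \<in> {2..r + 1}" for i
      using that
    proof (induction "r + 1 - i" arbitrary: i rule: less_induct)
      case (less i)
      let ?a = "2 * r - i" and ?b = "r + 2 - i"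
      have i: "2 \<le> i" "i \<le> r + 1" using less.prems by auto
      \<comment> \<open>Larger first letters have fewer factors \<open>1 - 2x\<close>.\<close>
      have above: "proper_form ?a ?b (word_series r j) 0" if "j \<in> {Suc i..r + 1}" for j
      proof -
        have "r + 1 - j < r + 1 - i" "j \<in> {2..r + 1}" using that i by auto
        from less.hyps[OF this]
        obtain y where "proper_form (2 * r + 1 - j) (r + 2 - j) (word_series r j) y" by blast
        then show ?thesis
          by (rule proper_form_weaken_0) (use that i in auto)
      qed
      \<comment> \<open>All these series carry exactly \<open>?b\<close> factors
        \<open>1 - 2x\<close>. For \<open>i = 2\<close> only \<open>j = 1\<close> occurs.\<close>
      have below: "\<exists>y. proper_form ?a ?b (fps_shift (i - j) (word_series (r - (i - j)) j)) y \<and>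
          (i = 2 \<longrightarrow> y = 4 * (1/2) ^ (r - 1))" if "j \<in> {1..<i}" for j
      proof -
        let ?r = "r - (i - j)"
        have "?r < r" "j \<in> {1..?r + 1}" using that i by auto
        from IH[OF this]
        obtain y where y: "proper_form (order_1 ?r j) (order_2 ?r j) (word_series ?r j) y"
          "j = 1 \<longrightarrow> y = 2 * (1/2) ^ (?r - 1)" by blast
        have b: "order_2 ?r j = ?b" using that i by (auto simp: order_2_def)
        have a: "order_1 ?r j \<le> ?a" using that i by (auto simp: order_1_def)
        have "proper_form ?a ?b (word_series ?r j) (y * (1/2) ^ (?a - order_1 ?r j))"
          using proper_form_weaken[OF y(1) a, of ?b] b by simp
        then have "proper_form ?a ?b (fps_shift (i - j) (word_series ?r j))
            (2 ^ (i - j) * (y * (1/2) ^ (?a - order_1 ?r j)))"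
          by (rule proper_form_shift) (use i in auto)
        moreover have "2 ^ (i - j) * (y * (1/2) ^ (?a - order_1 ?r j)) = 4 * (1/2) ^ (r - 1)" if "i = 2"
        proof -
          have j: "j = 1" using \<open>j \<in> {1..<i}\<close> that by auto
          show ?thesis
          proof (cases "r = 1")
            \<comment> \<open>Level 0 is special: both \<open>order_1 0 1\<close> and the exponent
              \<open>?r - 1\<close> are truncated to 0, so there is no spare factor
              \<open>1 - x\<close>.\<close>
            case True
            then show ?thesis using y(2) that j by (simp add: order_1_def)
          next
            case False
            then have "r = Suc (Suc (r - 2))" using r by simp
            then obtain s where "r = Suc (Suc s)" ..
            then show ?thesis using y(2) that j by (simp add: order_1_def)
          qed
        qed
        ultimately show ?thesis by blast
      qed
      have "\<exists>y. \<forall>j\<in>{1..<i}.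
          proper_form ?a ?b (fps_shift (i - j) (word_series (r - (i - j)) j)) (y j) \<and>
          (i = 2 \<longrightarrow> y j = 4 * (1/2) ^ (r - 1))"
        by (intro bchoice ballI below)
      then obtain y where y: "\<And>j. j \<in> {1..<i} \<Longrightarrow>
          proper_form ?a ?b (fps_shift (i - j) (word_series (r - (i - j)) j)) (y j) \<and>
          (i = 2 \<longrightarrow> y j = 4 * (1/2) ^ (r - 1))" by blast
      have "proper_form ?a ?b ((\<Sum>j = 1..<i. fps_shift (i - j) (word_series (r - (i - j)) j)) +
          (\<Sum>j = Suc i..r + 1. word_series r j)) (sum y {1..<i} + (\<Sum>j = Suc i..r + 1. 0))"
        by (intro proper_form_add proper_form_sum) (use y above in auto)
      then have "proper_form (Suc ?a) ?b (word_series r i) ((sum y {1..<i} + (\<Sum>j = Suc i..r + 1. 0)) / 2)"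
        by (rule proper_form_solve_1[rotated]) (use word_series_rec[OF r, of i] i in auto)
      moreover have "Suc ?a = 2 * r + 1 - i" using i r by auto
      moreover have "sum y {1..<i} / 2 = 2 * (1/2) ^ (r - 1)" if "i = 2"
      proof -
        have "{1..<i} = {1}" using that by auto
        then show ?thesis using y[of 1] that by simp
      qed
      ultimately show ?case by auto
    qed
    show ?thesis
    proof (cases "i = 1")
      case False
      then show ?thesis using step[of i] less.prems by (auto simp: order_1_def order_2_def)
    next
      case True
      \<comment> \<open>Among the summands for \<open>i = 1\<close> only \<open>j = 2\<close> has
        \<open>r\<close> factors \<open>1 - 2x\<close>, so it alone determines the value.\<close>
      obtain y where y: "proper_form (2 * r - 1) r (word_series r 2) y" "y = 2 * (1/2) ^ (r - 1)"
        using step[of 2] r by auto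
      have "proper_form (2 * r - 1) r (word_series r j) 0" if "j \<in> {3..r + 1}" for j
      proof -
        have "j \<in> {2..r + 1}" using that by simp
        from step[OF this]
        obtain y where "proper_form (2 * r + 1 - j) (r + 2 - j) (word_series r j) y" by blast
        then show ?thesis
          by (rule proper_form_weaken_0) (use that in auto)
      qed
      then have "proper_form (2 * r - 1) r (word_series r 2 + (\<Sum>j = 3..r + 1. word_series r j))
          (y + (\<Sum>j = 3..r + 1. 0))"
        by (intro proper_form_add[OF y(1)] proper_form_sum) auto
      moreover have "{2..r + 1} = insert 2 {3..r + 1}" using r by auto
      ultimately have "proper_form (2 * r - 1) r (\<Sum>j = 2..r + 1. word_series r j) y"
        by simp
      then have "proper_form (2 * r - 1) (Suc r) (word_series r 1) y"
        by (rule proper_form_solve_2[rotated])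
           (use word_series_rec[OF r, of 1] r in \<open>auto simp: numeral_2_eq_2\<close>)
      then show ?thesis using True y(2) by (auto simp: order_1_def order_2_def)
    qed
  qed
qed

section \<open>Positivity of the counts at length \<open>r + 1\<close>\<close>

text \<open>Prepending a new largest letter creates no occurrence; the decreasing word is a
  witness.\<close>

lemma word_count_pos_0: "word_count (Suc m) 0 (Suc m) > 0"
proof (induction m)
  case 0
  then show ?case by (simp add: word_count_1)
next
  case (Suc m)
  have "word_count (Suc m) 0 (Suc m) \<le> (\<Sum>j = 1..Suc m. word_count (Suc m) 0 j)"
    by (rule member_le_sum) auto
  also have "\<dots> = (\<Sum>j = 1..Suc m. if j - Suc (Suc m) \<le> 0 then word_count (Suc m) (0 - (j - Suc (Suc m))) j else 0)"
    by (intro sum.cong) auto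
  also have "\<dots> = word_count (Suc (Suc m)) 0 (Suc (Suc m))"
    by (subst word_count_Suc) auto
  finally show ?case using Suc by linarith
qed

lemma word_count_Suc_ge:
  assumes "1 \<le> i" "i \<le> Suc m" "1 \<le> j" "j \<le> m" "j - i \<le> s"
  shows "word_count m (s - (j - i)) j \<le> word_count (Suc m) s i"
proof -
  let ?F = "\<lambda>j. if j - i \<le> s then word_count m (s - (j - i)) j else 0"
  have "?F j \<le> sum ?F {1..m}"
    by (rule member_le_sum) (use assms in auto)
  also have "\<dots> \<le> word_count (Suc m) s i"
    using assms by (subst word_count_Suc) auto
  finally show ?thesis using assms(5) by simp
qed

text \<open>The word 132 arises from 21 by prepending 1; prepending 1 to a word that begins with 1
  creates no further occurrence.\<close>

lemma word_count_pos_1: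
  assumes "m \<ge> 3"
  shows "word_count m 1 1 > 0"
  using assms
proof (induction m rule: dec_induct)
  case base
  have "0 < word_count 2 0 2" using word_count_pos_0[of 1] by (simp add: numeral_2_eq_2)
  also have "\<dots> \<le> word_count 3 1 1" using word_count_Suc_ge[of 1 2 2 1] by simp
  finally show ?case .
next
  case (step m)
  then show ?case using word_count_Suc_ge[of 1 m 1 1] by simp
qed

text \<open>Prepending \<open>i\<close> to a word that begins with its largest letter \<open>n\<close> and has one occurrence
  creates \<open>n - i\<close> further occurrences.\<close>

lemma word_count_critical_pos:
  assumes "r \<ge> 4" "1 \<le> i" "i \<le> r + 1"
  shows "word_count (r + 1) (r + 1 - i) i > 0"
proof (cases "i = r + 1")
  case True
  then show ?thesis using word_count_pos_0[of r] by simp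
next
  case False
  \<comment> \<open>Here \<open>r \<ge> 4\<close> enters: a word with an occurrence needs at least
    three letters. Prepending the largest letter \<open>r\<close> then keeps the single
    occurrence.\<close>
  have "0 < word_count (r - 1) 1 1" using assms by (intro word_count_pos_1) simp
  also have "\<dots> \<le> word_count r 1 r"
    using word_count_Suc_ge[of r "r - 1" 1 1] assms by simp
  also have "\<dots> \<le> word_count (r + 1) (r + 1 - i) i"
    using word_count_Suc_ge[of i r r "r + 1 - i"] assms False by simp
  finally show ?thesis .
qed

section \<open>Numerators\<close>

text \<open>The last letter of a word is always a right-to-left minimum.\<close>

lemma even_word_count:
  assumes "m \<ge> 1" "1 \<le> i" "i \<le> m"
  shows "2 dvd word_count m s i"
  using assms
proof (induction m arbitrary: s i rule: dec_induct)
  case base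
  then show ?case by (simp add: word_count_1)
next
  case (step m)
  then have "2 dvd (\<Sum>j = 1..m. if j - i \<le> s then word_count m (s - (j - i)) j else 0)"
    by (intro dvd_sum) auto
  then show ?case using step by (subst word_count_Suc) auto
qed

text \<open>A leading 1 and the last letter are two different right-to-left minima.\<close>

lemma four_dvd_word_count:
  assumes "m \<ge> 2"
  shows "4 dvd word_count m s 1"
proof -
  obtain k where m: "m = Suc k" "k \<ge> 1" using assms by (cases m) auto
  have "2 dvd (\<Sum>j = 1..k. if j - 1 \<le> s then word_count k (s - (j - 1)) j else 0)"
    using even_word_count[of k] m by (intro dvd_sum) auto
  then have "2 * 2 dvd 2 * (\<Sum>j = 1..k. if j - 1 \<le> s then word_count k (s - (j - 1)) j else 0)"
    by (rule mult_dvd_mono[OF dvd_refl])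
  moreover have "word_count m s 1 = 2 * (\<Sum>j = 1..k. if j - 1 \<le> s then word_count k (s - (j - 1)) j else 0)"
    unfolding m(1) using m(2) word_count_Suc[of k 1 s] by (simp only: if_True) auto
  ultimately show ?thesis by simp
qed

definition integral_coeffs :: "rat poly \<Rightarrow> bool" where
  "integral_coeffs p \<longleftrightarrow> (\<forall>n. coeff p n \<in> \<int>)"

lemma integral_coeffs_mult: "integral_coeffs p \<Longrightarrow> integral_coeffs q \<Longrightarrow> integral_coeffs (p * q)"
  by (auto simp: integral_coeffs_def coeff_mult intro!: Ints_sum Ints_mult)

lemma integral_coeffs_power: "integral_coeffs p \<Longrightarrow> integral_coeffs (p ^ n)"
  by (induction n) (auto intro: integral_coeffs_mult simp: integral_coeffs_def[of 1])

lemma integral_coeffs_denom: "integral_coeffs (denom a b)"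
  unfolding denom_def
  by (intro integral_coeffs_mult integral_coeffs_power)
     (auto simp: integral_coeffs_def coeff_pCons split: nat.split)

text \<open>The numerator is the product of the series with \<open>denom a b\<close>, which has
  integer coefficients.\<close>

lemma integral_coeffs_smult_numerator:
  assumes "fps_of_poly (denom a b) * F = fps_of_poly p" "\<And>n. u * fps_nth F n \<in> \<int>"
  shows "integral_coeffs (smult u p)"
  unfolding integral_coeffs_def
proof
  fix n
  have "coeff (smult u p) n = u * fps_nth (fps_of_poly (denom a b) * F) n"
    by (simp add: assms(1))
  also have "\<dots> = (\<Sum>i\<le>n. coeff (denom a b) i * (u * fps_nth F (n - i)))"
    unfolding fps_mult_nth sum_distrib_left atLeast0AtMost by (intro sum.cong refl) simp
  also have "\<dots> \<in> \<int>"
    using integral_coeffs_denom assms(2)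
    by (intro Ints_sum Ints_mult[OF _ assms(2)]) (auto simp: integral_coeffs_def)
  finally show "coeff (smult u p) n \<in> \<int>" .
qed

lemma integral_coeffsE:
  assumes "integral_coeffs p"
  obtains q :: "int poly" where "p = map_poly of_int q"
proof
  show "p = map_poly of_int (map_poly floor p)"
  proof (rule poly_eqI)
    fix n
    obtain k where "coeff p n = of_int k"
      using assms by (auto simp: integral_coeffs_def elim: Ints_cases)
    then show "coeff p n = coeff (map_poly of_int (map_poly floor p)) n"
      by (simp add: coeff_map_poly)
  qed
qed

section \<open>Expansion in powers of v\<close>

lemma v_coeff_of_x_series_mult: "v_coeff (of_x_series f * F) l = f * v_coeff F l"
  by (rule fps_ext) (simp add: v_coeff_def of_x_series_def fps_mult_nth coeff_sum)

lemma of_x_series_mult: "of_x_series (f * h) = of_x_series f * of_x_series h"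
  by (rule fps_ext, rule poly_eqI)
     (simp add: of_x_series_def fps_mult_nth coeff_sum coeff_pCons mult.commute split: nat.split)

lemma of_x_series_diff: "of_x_series (f - h) = of_x_series f - of_x_series h"
  by (rule fps_ext) (simp add: of_x_series_def)

lemma of_x_series_const: "of_x_series (fps_const a) = fps_const [:a:]"
  by (rule fps_ext) (simp add: of_x_series_def)

lemma of_x_series_numeral: "of_x_series (numeral k) = numeral k"
  using of_x_series_const[of "numeral k"] by (simp add: numeral_fps_const numeral_poly)

lemma of_x_series_1: "of_x_series 1 = 1"
  using of_x_series_const[of 1] by (simp add: one_pCons[symmetric])

lemma of_x_series_X: "of_x_series fps_X = fps_X"
  by (rule fps_ext) (simp add: of_x_series_def fps_X_def one_pCons)

lemma of_x_series_power: "of_x_series (f ^ n) = of_x_series f ^ n"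
  by (induction n) (simp_all add: of_x_series_1 of_x_series_mult)

lemmas of_x_series_simps = of_x_series_mult of_x_series_diff of_x_series_const
  of_x_series_numeral of_x_series_1 of_x_series_X of_x_series_power

lemma eq_sum_v_coeff:
  assumes "\<And>l. l > r \<Longrightarrow> v_coeff F l = 0"
  shows "F = (\<Sum>l\<le>r. of_x_series (v_coeff F l) * var_v ^ l)"
proof (rule fps_ext, rule poly_eqI)
  fix n k
  have var: "var_v ^ l = fps_const (monom 1 l)" for l
    by (simp add: var_v_def monom_altdef flip: fps_const_power)
  have "coeff (fps_nth (\<Sum>l\<le>r. of_x_series (v_coeff F l) * var_v ^ l) n) k =
      (\<Sum>l\<le>r. if l = k then coeff (fps_nth F n) l else 0)"
    by (simp add: fps_sum_nth coeff_sum var of_x_series_def v_coeff_def coeff_monom if_distrib cong: if_cong)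
  also have "\<dots> = (if k \<le> r then coeff (fps_nth F n) k else 0)"
    by simp
  also have "\<dots> = coeff (fps_nth F n) k"
    using arg_cong[OF assms[of k], of "\<lambda>f. fps_nth f n"] by (auto simp: v_coeff_def)
  finally show "coeff (fps_nth F n) k =
      coeff (fps_nth (\<Sum>l\<le>r. of_x_series (v_coeff F l) * var_v ^ l) n) k" ..
qed

text \<open>The power \<open>l\<close> of v belongs to \<open>i = l + 2\<close>, hence to words with
  first letter \<open>l + 1\<close>. Their length \<open>n - 1\<close> starts at
  \<open>r + 2\<close>, one more than in \<open>word_series\<close>; hence the shift by 1.\<close>

lemma v_coeff_G:
  "v_coeff (fps_shift (r + 3) (G r)) l = (if l \<le> r then fps_shift 1 (word_series r (l + 1)) else 0)"
proof (rule fps_ext)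
  fix m
  let ?n = "m + (r + 3)"
  have "fps_nth (v_coeff (fps_shift (r + 3) (G r)) l) m =
      (\<Sum>i = 2..?n. if i = l + 2 then of_nat (g ?n r i) else 0)"
  proof -
    have "fps_nth (v_coeff (fps_shift (r + 3) (G r)) l) m =
        (\<Sum>i = 2..?n. coeff (monom (of_nat (g ?n r i)) (i - 2)) l)"
      by (simp add: v_coeff_def G_def coeff_sum)
    also have "\<dots> = (\<Sum>i = 2..?n. if i = l + 2 then of_nat (g ?n r i) else 0)"
      by (intro sum.cong refl) (auto simp: coeff_monom)
    finally show ?thesis .
  qed
  also have "\<dots> = (if l + 2 \<le> ?n then of_nat (g ?n r (l + 2)) else 0)"
    by simp
  also have "\<dots> = fps_nth (if l \<le> r then fps_shift 1 (word_series r (l + 1)) else 0) m"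
    by (auto simp: g_eq_word_count word_series_def numeral_3_eq_3 add_ac)
  finally show "fps_nth (v_coeff (fps_shift (r + 3) (G r)) l) m =
      fps_nth (if l \<le> r then fps_shift 1 (word_series r (l + 1)) else 0) m" .
qed

lemma v_coeff_P:
  "v_coeff (P r) l = (if l \<le> r then fps_of_poly (denom (2 * r - 1) (r + 1)) * fps_const (1/2) *
     fps_shift 1 (word_series r (l + 1)) else 0)"
proof -
  have "P r = of_x_series (fps_of_poly (denom (2 * r - 1) (r + 1)) * fps_const (1/2)) *
      fps_shift (r + 3) (G r)"
    by (simp only: P_def fps_of_poly_denom of_x_series_simps)
  then show ?thesis
    by (simp add: v_coeff_of_x_series_mult v_coeff_G)
qed

lemma fps_divide_unit_mult:
  fixes f d :: "rat fps"
  assumes "fps_nth d 0 \<noteq> 0"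
  shows "f / d * d = f"
  using assms by (simp add: fps_divide_unit mult.assoc inverse_mult_eq_1)

lemma v_coeff_P_0: "v_coeff (P r) 0 = 2 * c r 0"
proof -
  have "v_coeff (P r) 0 / 2 * 2 = v_coeff (P r) 0"
    by (rule fps_divide_unit_mult) (simp add: numeral_fps_const)
  then show ?thesis by (simp add: c_def mult.commute)
qed

lemma v_coeff_P_pos:
  assumes "l \<ge> 1"
  shows "v_coeff (P r) l = c r l * fps_of_poly (denom (l - 1) l)"
proof -
  have "v_coeff (P r) l / fps_of_poly (denom (l - 1) l) * fps_of_poly (denom (l - 1) l) = v_coeff (P r) l"
    by (rule fps_divide_unit_mult) (simp add: coeff_0_denom)
  then show ?thesis using assms by (simp add: c_def fps_of_poly_denom)
qed

text \<open>The weights of the words of length at least 2 that begin with 1 are divisible by 4,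
  which makes up for the extra factor 2 in front of \<open>c r 0\<close>.\<close>

lemma c_eq_poly:
  assumes "r \<ge> 1" "l \<le> r"
  obtains q :: "int poly" where "c r l = fps_of_poly (map_poly of_int q)"
    "l = 0 \<Longrightarrow> poly (map_poly of_int q) (1/2 :: rat) = (1/2) ^ (r - 1)"
    "r \<ge> 4 \<Longrightarrow> degree q = (if l = 0 then 3 * r - 1 else 3 * r - 2 * l)"
proof -
  define a b where ab: "a = order_1 r (l + 1)" "b = order_2 r (l + 1)"
  \<comment> \<open>The factor 1/2 from \<open>P\<close>, halved once more for \<open>l = 0\<close>
    because the expansion contains \<open>2 * c r 0\<close>.\<close>
  define u :: rat where "u = (if l = 0 then 1/4 else 1/2)"
  let ?F = "word_series r (l + 1)"
  obtain y where y: "proper_form a b ?F y" "l = 0 \<longrightarrow> y = 2 * (1/2) ^ (r - 1)"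
    using proper_form_word_series[of "l + 1" r] assms(2) by (auto simp: ab)
  have "b \<ge> 1" using assms by (auto simp: ab order_2_def)
  from proper_form_shift_leading[OF y(1) this]
  obtain p where p: "fps_of_poly (denom a b) * fps_shift 1 ?F = fps_of_poly p"
    "\<forall>k \<ge> a + b. coeff p k = 0" "poly p (1/2) = 2 * y"
    "coeff p (a + b - 1) = - ((-1) ^ a * (-2) ^ b * fps_nth ?F 0)" by blast
  have "u * fps_nth (fps_shift 1 ?F) n \<in> \<int>" for n
  proof -
    define W where "W = word_count (r + 1 + (n + 1)) (r + 1 - (l + 1)) (l + 1)"
    have W: "fps_nth (fps_shift 1 ?F) n = of_nat W"
      by (simp add: word_series_def W_def)
    obtain k where "W = (if l = 0 then 4 else 2) * k"
    proof (cases "l = 0")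
      case True
      then have "4 dvd W" unfolding W_def by (simp add: four_dvd_word_count[simplified])
      then show thesis using that True by (auto elim: dvdE)
    next
      case False
      then have "2 dvd W" unfolding W_def using assms(2) by (intro even_word_count) auto
      then show thesis using that False by (auto elim: dvdE)
    qed
    then have "u * fps_nth (fps_shift 1 ?F) n = of_nat k"
      unfolding W by (simp add: u_def)
    then show ?thesis by simp
  qed
  then have "integral_coeffs (smult u p)"
    by (rule integral_coeffs_smult_numerator[OF p(1)])
  then obtain q where q: "smult u p = map_poly of_int q"
    by (rule integral_coeffsE)
  have "c r l = fps_const u * fps_of_poly p"
  proof (cases "l = 0")
    case True
    have "2 * c r 0 = fps_of_poly (denom a b) * fps_const (1/2) * fps_shift 1 ?F"
      using v_coeff_P_0[of r] True by (simp add: v_coeff_P ab order_1_def order_2_def)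
    also have "fps_const (1/2) = 2 * fps_const u"
      using True by (simp add: u_def numeral_fps_const)
    also have "fps_of_poly (denom a b) * (2 * fps_const u) * fps_shift 1 ?F =
        2 * (fps_const u * fps_of_poly p)"
      unfolding p(1)[symmetric] by (simp only: mult_ac)
    finally show ?thesis using True by simp
  next
    case False
    \<comment> \<open>The divisor of \<open>c r l\<close> removes exactly the surplus of the
      prefactor of \<open>P r\<close> over the denominator of
      \<open>word_series r (l + 1)\<close>.\<close>
    have "denom (2 * r - 1) (r + 1) = denom (l - 1) l * denom a b"
      using denom_add[of "l - 1" a l b] False assms by (simp add: ab order_1_def order_2_def)
    then have "c r l * fps_of_poly (denom (l - 1) l) =
        fps_of_poly (denom (l - 1) l * denom a b) * fps_const (1/2) * fps_shift 1 ?F"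
      using v_coeff_P_pos[of l r] False assms(2) by (simp add: v_coeff_P)
    also have "\<dots> = fps_const u * fps_of_poly p * fps_of_poly (denom (l - 1) l)"
      unfolding p(1)[symmetric] using False by (simp add: u_def fps_of_poly_mult mult_ac)
    finally show ?thesis
      using coeff_0_denom[of "l - 1" l] by (metis fps_of_poly_nth fps_zero_nth mult_cancel_right zero_neq_one)
  qed
  then have "c r l = fps_of_poly (map_poly of_int q)"
    by (simp add: q[symmetric] fps_of_poly_smult)
  moreover have "poly (map_poly of_int q) (1/2 :: rat) = (1/2) ^ (r - 1)" if "l = 0"
    unfolding q[symmetric] using that p(3) y(2) by (simp add: u_def)
  moreover have "degree q = (if l = 0 then 3 * r - 1 else 3 * r - 2 * l)" if "r \<ge> 4"
  proof -
    \<comment> \<open>Properness bounds the degree by \<open>a + b - 1\<close>, and this positive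
      constant term shows that the bound is attained.\<close>
    have "fps_nth ?F 0 > 0"
      using word_count_critical_pos[of r "l + 1"] that assms(2) by (simp add: word_series_def)
    then have "coeff p (a + b - 1) \<noteq> 0" unfolding p(4) by simp
    then have "a + b - 1 \<le> degree p" by (rule le_degree)
    moreover have "degree p \<le> a + b - 1"
      by (rule degree_le) (use p(2) in auto)
    moreover have "degree q = degree (smult u p)"
      unfolding q by (simp add: degree_map_poly)
    moreover have "degree (smult u p) = degree p" by (simp add: u_def)
    ultimately show ?thesis
      using assms by (auto simp: ab order_1_def order_2_def)
  qed
  ultimately show thesis by (rule that)
qed

text \<open>Only finitely many powers of v occur, so the sum of the degrees of the
  \<open>w l\<close> bounds the degree in x uniformly.\<close>

lemma eq_of_xv_polyI:
  assumes "\<And>l. v_coeff F l = fps_of_poly (w l)" "\<And>l. integral_coeffs (w l)" "\<And>l. l > r \<Longrightarrow> w l = 0"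
  shows "\<exists>p :: int poly poly. F = of_xv_poly p"
proof -
  define N where "N = Suc (\<Sum>l\<le>r. degree (w l))"
  have coeff: "coeff (fps_nth F n) l = coeff (w l) n" for n l
    using arg_cong[OF assms(1)[of l], of "\<lambda>f. fps_nth f n"] by (simp add: v_coeff_def)
  have high: "fps_nth F n = 0" if "n \<ge> N" for n
  proof (rule poly_eqI)
    fix l
    have "coeff (w l) n = 0"
    proof (cases "l \<le> r")
      case True
      then have "degree (w l) \<le> (\<Sum>l\<le>r. degree (w l))" by (intro member_le_sum) auto
      then show ?thesis using that by (intro coeff_eq_0) (simp add: N_def)
    qed (simp add: assms(3))
    then show "coeff (fps_nth F n) l = coeff 0 l" by (simp add: coeff)
  qed
  define p where "p = Poly (map (\<lambda>n. map_poly floor (fps_nth F n)) [0..<N])"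
  have "F = of_xv_poly p"
  proof (rule fps_ext, rule poly_eqI)
    fix n l
    obtain k where "coeff (fps_nth F n) l = of_int k"
      using assms(2)[of l] unfolding coeff integral_coeffs_def by (metis Ints_cases)
    then show "coeff (fps_nth F n) l = coeff (fps_nth (of_xv_poly p) n) l"
      using high[of n]
      by (cases "n < N") (auto simp: of_xv_poly_def p_def coeff_map_poly nth_default_def)
  qed
  then show ?thesis ..
qed

theorem theorem3p6:
  fixes r :: nat
  assumes "r \<ge> 1"
  shows "(\<exists>p :: int poly poly. P r = of_xv_poly p) \<and>
    P r = 2 * of_x_series (c r 0) +
      (\<Sum>l=1..r. of_x_series (c r l) * (1 - fps_X) ^ (l - 1) * (1 - 2 * fps_X) ^ l * var_v ^ l) \<and>
    (\<exists>q :: nat \<Rightarrow> int poly.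
      (\<forall>l\<le>r. c r l = fps_of_poly (map_poly of_int (q l))) \<and>
      (r \<ge> 4 \<longrightarrow> degree (q 0) = 3 * r - 1) \<and>
      poly (map_poly of_int (q 0)) (1 / 2 :: rat) = 2 powi (1 - int r) \<and>
      (r \<ge> 4 \<longrightarrow> (\<forall>l\<in>{1..r}. degree (q l) = 3 * r - 2 * l)))"
proof (intro conjI)
  let ?Q = "\<lambda>l (q :: int poly). c r l = fps_of_poly (map_poly of_int q) \<and>
    (l = 0 \<longrightarrow> poly (map_poly of_int q) (1/2 :: rat) = (1/2) ^ (r - 1)) \<and>
    (r \<ge> 4 \<longrightarrow> degree q = (if l = 0 then 3 * r - 1 else 3 * r - 2 * l))"
  have "\<forall>l\<in>{..r}. \<exists>q. ?Q l q"
  proof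
    fix l assume "l \<in> {..r}"
    then have "l \<le> r" by simp
    show "\<exists>q. ?Q l q" by (rule c_eq_poly[OF assms \<open>l \<le> r\<close>]) blast
  qed
  from bchoice[OF this] obtain q where "\<forall>l\<in>{..r}. ?Q l (q l)" ..
  then have Q: "?Q l (q l)" if "l \<le> r" for l
    by (rule bspec) (use that in simp)
  have q: "\<And>l. l \<le> r \<Longrightarrow> c r l = fps_of_poly (map_poly of_int (q l))"
    "poly (map_poly of_int (q 0)) (1/2 :: rat) = (1/2) ^ (r - 1)"
    "\<And>l. l \<le> r \<Longrightarrow> r \<ge> 4 \<Longrightarrow> degree (q l) = (if l = 0 then 3 * r - 1 else 3 * r - 2 * l)"
    using Q by blast+
  have "(1/2 :: rat) ^ (r - 1) = 2 powi (1 - int r)"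
  proof -
    obtain s where "r = Suc s" using assms by (cases r) auto
    then have "1 - int r = - int s" "r - 1 = s" by simp_all
    then show ?thesis
      by (simp only: power_int_minus power_int_of_nat power_one_over inverse_eq_divide)
  qed
  then show "\<exists>q :: nat \<Rightarrow> int poly.
      (\<forall>l\<le>r. c r l = fps_of_poly (map_poly of_int (q l))) \<and>
      (r \<ge> 4 \<longrightarrow> degree (q 0) = 3 * r - 1) \<and>
      poly (map_poly of_int (q 0)) (1 / 2 :: rat) = 2 powi (1 - int r) \<and>
      (r \<ge> 4 \<longrightarrow> (\<forall>l\<in>{1..r}. degree (q l) = 3 * r - 2 * l))"
    using q by (intro exI[of _ q]) auto

  show "P r = 2 * of_x_series (c r 0) +
      (\<Sum>l=1..r. of_x_series (c r l) * (1 - fps_X) ^ (l - 1) * (1 - 2 * fps_X) ^ l * var_v ^ l)"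
  proof -
    have "P r = (\<Sum>l\<le>r. of_x_series (v_coeff (P r) l) * var_v ^ l)"
      by (rule eq_sum_v_coeff) (simp add: v_coeff_P)
    also have "{..r} = insert 0 {1..r}" by auto
    also have "(\<Sum>l\<in>\<dots>. of_x_series (v_coeff (P r) l) * var_v ^ l) =
        2 * of_x_series (c r 0) + (\<Sum>l=1..r. of_x_series (v_coeff (P r) l) * var_v ^ l)"
      by (simp add: v_coeff_P_0 of_x_series_simps)
    also have "(\<Sum>l=1..r. of_x_series (v_coeff (P r) l) * var_v ^ l) =
        (\<Sum>l=1..r. of_x_series (c r l) * (1 - fps_X) ^ (l - 1) * (1 - 2 * fps_X) ^ l * var_v ^ l)"
      by (intro sum.cong refl) (simp add: v_coeff_P_pos fps_of_poly_denom of_x_series_simps mult.assoc)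
    finally show ?thesis .
  qed

  \<comment> \<open>The coefficients of \<open>P r\<close> in v, with the divisors from the
    definition of \<open>c\<close> multiplied back.\<close>
  define w where "w l = (if l > r then 0 else if l = 0 then smult 2 (map_poly of_int (q 0))
    else map_poly of_int (q l) * denom (l - 1) l)" for l
  show "\<exists>p :: int poly poly. P r = of_xv_poly p"
  proof (rule eq_of_xv_polyI)
    show "v_coeff (P r) l = fps_of_poly (w l)" for l
      using v_coeff_P[of r l] v_coeff_P_0[of r] v_coeff_P_pos[of l r] q(1)
      by (auto simp: w_def fps_of_poly_mult fps_of_poly_smult numeral_fps_const)
    show "integral_coeffs (w l)" for l
    proof -
      have "integral_coeffs (map_poly of_int (q l))" "integral_coeffs (smult 2 (map_poly of_int (q 0)))"
        by (simp_all add: integral_coeffs_def coeff_map_poly)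
      moreover have "integral_coeffs 0" by (simp add: integral_coeffs_def)
      ultimately show ?thesis
        by (simp add: w_def integral_coeffs_mult integral_coeffs_denom)
    qed
    show "w l = 0" if "l > r" for l using that by (simp add: w_def)
  qed
qed

end
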